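(* Let $G$ be a finite group and let $p$ be a prime. If $G$ is $p$-solvable of $p$-length $k$, then $d_{p'}(G)\le \big(2/(p+1)\big)^{k-1}$.
   Context: For a finite group $G$ and prime $p$, $k_{p'}(G)$ denotes the number of conjugacy classes of elements of $G$ whose order is not divisible by $p$, $|G|_{p'}$ is the largest divisor of $|G|$ coprime to $p$, and $d_{p'}(G)=k_{p'}(G)/|G|_{p'}$. $G$ is $p$-solvable if it has a normal series each of whose factors is a $p$-group or a group of order coprime to $p$; its $p$-length is the minimum number of factors that are $p$-groups among such normal series. *)

theory Defs
  imports "HOL-Algebra.Algebra" "HOL-Computational_Algebra.Primes"
begin

definition conj_class :: "('a, 'b) monoid_scheme \<Rightarrow> 'a \<Rightarrow> 'a set" where
  "conj_class G x = {g \<otimes>\<^bsub>G\<^esub> x \<otimes>\<^bsub>G\<^esub> inv\<^bsub>G\<^esub> g | g. g \<in> carrier G}"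

definition p'_elements :: "('a, 'b) monoid_scheme \<Rightarrow> nat \<Rightarrow> 'a set" where
  "p'_elements G p = {x \<in> carrier G. \<not> p dvd group.ord G x}"

definition k_p' :: "('a, 'b) monoid_scheme \<Rightarrow> nat \<Rightarrow> nat" where
  "k_p' G p = card (conj_class G ` p'_elements G p)"

definition order_p' :: "('a, 'b) monoid_scheme \<Rightarrow> nat \<Rightarrow> nat" where
  "order_p' G p = Max {d. d dvd order G \<and> coprime d p}"

definition d_p' :: "('a, 'b) monoid_scheme \<Rightarrow> nat \<Rightarrow> real" where
  "d_p' G p = real (k_p' G p) / real (order_p' G p)"

definition factor_order :: "(nat \<Rightarrow> 'a set) \<Rightarrow> nat \<Rightarrow> nat" where
  "factor_order H i = card (H (Suc i)) div card (H i)"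

definition p_series :: "('a, 'b) monoid_scheme \<Rightarrow> nat \<Rightarrow> nat \<Rightarrow> (nat \<Rightarrow> 'a set) \<Rightarrow> bool" where
  "p_series G p n H \<longleftrightarrow>
     H 0 = {\<one>\<^bsub>G\<^esub>} \<and> H n = carrier G \<and>
     (\<forall>i\<le>n. H i \<lhd> G) \<and> (\<forall>i<n. H i \<subseteq> H (Suc i)) \<and>
     (\<forall>i<n. (\<exists>m. factor_order H i = p ^ m) \<or> coprime (factor_order H i) p)"

definition num_p_factors :: "nat \<Rightarrow> nat \<Rightarrow> (nat \<Rightarrow> 'a set) \<Rightarrow> nat" where
  "num_p_factors p n H = card {i. i < n \<and> (\<exists>m>0. factor_order H i = p ^ m)}"

definition p_solvable :: "('a, 'b) monoid_scheme \<Rightarrow> nat \<Rightarrow> bool" where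
  "p_solvable G p \<longleftrightarrow> (\<exists>n H. p_series G p n H)"

definition p_length :: "('a, 'b) monoid_scheme \<Rightarrow> nat \<Rightarrow> nat" where
  "p_length G p = (LEAST k. \<exists>n H. p_series G p n H \<and> num_p_factors p n H = k)"

end

theory Submission
  imports Defs "HOL-Number_Theory.Cong"
begin

text \<open>Let \<open>k(M)\<close> be the number of classes of \<open>p'\<close>-elements of \<open>M\<close>. For normal \<open>N\<close>, every coset of
  \<open>N\<close> contains at most \<open>k(N)\<close> orbits of \<open>p'\<close>-elements under conjugation by \<open>N\<close>; this follows from
  Burnside's count by shifting the \<open>p\<close>-part of one member of a commuting pair to the other. So
  \<open>k(M) \<le> t k(N)\<close> when \<open>t\<close> cosets represent all \<open>M\<close>-orbits of cosets containing \<open>p'\<close>-elements.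
  If \<open>M / N\<close> is a \<open>p\<close>-group, \<open>t = 1\<close> suffices; if it is a \<open>p'\<close>-group, one may take its order.
  If \<open>M / L\<close> has a normal \<open>p'\<close>-subgroup \<open>K\<close> whose quotient is a \<open>p\<close>-group, only orbits on \<open>K\<close> matter.
  A \<open>p\<close>-element \<open>x\<close> acting nontrivially on \<open>K\<close> has fixed points of index \<open>\<ge> p + 1\<close> and all other
  orbits of length \<open>\<ge> p\<close>, which leaves at most \<open>2 |K| / (p + 1)\<close> orbits. If no such \<open>x\<close> exists, the
  Sylow \<open>p\<close>-subgroup of \<open>M / L\<close> is normal, and the \<open>p\<close>-factor can be moved below \<open>K\<close>. In a series
  with the least number of \<open>p\<close>-factors this is impossible for each \<open>p\<close>-factor after the first.\<close>

section \<open>Orbits under conjugation by a subgroup\<close>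

text \<open>Restricting the conjugating elements to a set \<open>N\<close> lets one notion cover the
  classes of \<open>G\<close>, the classes of a subgroup, and the action of a subgroup on a coset or
  on a normal subgroup.\<close>

definition conj_orbit :: "('a, 'b) monoid_scheme \<Rightarrow> 'a set \<Rightarrow> 'a \<Rightarrow> 'a set" where
  "conj_orbit G N x = (\<lambda>g. g \<otimes>\<^bsub>G\<^esub> x \<otimes>\<^bsub>G\<^esub> inv\<^bsub>G\<^esub> g) ` N"

definition num_orbits :: "('a, 'b) monoid_scheme \<Rightarrow> 'a set \<Rightarrow> 'a set \<Rightarrow> nat" where
  "num_orbits G N A = card (conj_orbit G N ` A)"

context group
begin

lemma inv_mult_cancel_left [simp]:
  "\<lbrakk>x \<in> carrier G; y \<in> carrier G\<rbrakk> \<Longrightarrow> inv x \<otimes> (x \<otimes> y) = y"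
  "\<lbrakk>x \<in> carrier G; y \<in> carrier G\<rbrakk> \<Longrightarrow> x \<otimes> (inv x \<otimes> y) = y"
  by (simp_all add: m_assoc[symmetric])

lemma conj_mult:
  "\<lbrakk>g \<in> carrier G; h \<in> carrier G; x \<in> carrier G\<rbrakk>
    \<Longrightarrow> g \<otimes> (h \<otimes> x \<otimes> inv h) \<otimes> inv g = (g \<otimes> h) \<otimes> x \<otimes> inv (g \<otimes> h)"
  by (simp add: m_assoc inv_mult_group)

lemma conj_eq_iff:
  assumes "g \<in> carrier G" "x \<in> carrier G" "y \<in> carrier G"
  shows "g \<otimes> x \<otimes> inv g = y \<longleftrightarrow> g \<otimes> x = y \<otimes> g"
  using inv_solve_right[of y "g \<otimes> x" g] assms by auto

lemma conj_orbit_closed: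
  "\<lbrakk>N \<subseteq> carrier G; x \<in> carrier G\<rbrakk> \<Longrightarrow> conj_orbit G N x \<subseteq> carrier G"
  by (auto simp: conj_orbit_def)

lemma conj_orbit_self:
  assumes "subgroup N G" "x \<in> carrier G"
  shows "x \<in> conj_orbit G N x"
  using assms subgroup.one_closed[OF assms(1)] unfolding conj_orbit_def
  by (intro image_eqI[of _ _ \<one>]) auto

lemma conj_orbit_eq:
  assumes N: "subgroup N G" and x: "x \<in> carrier G" and y: "y \<in> conj_orbit G N x"
  shows "conj_orbit G N y = conj_orbit G N x"
proof -
  have sub: "conj_orbit G N (h \<otimes> z \<otimes> inv h) \<subseteq> conj_orbit G N z"
    if "h \<in> N" "z \<in> carrier G" for h z
  proof
    fix w assume "w \<in> conj_orbit G N (h \<otimes> z \<otimes> inv h)"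
    then obtain g where g: "g \<in> N" "w = g \<otimes> (h \<otimes> z \<otimes> inv h) \<otimes> inv g"
      by (auto simp: conj_orbit_def)
    then have "w = (g \<otimes> h) \<otimes> z \<otimes> inv (g \<otimes> h)"
      using conj_mult[of g h z] that subgroup.subset[OF N] by auto
    then show "w \<in> conj_orbit G N z"
      using g that subgroup.m_closed[OF N] by (auto simp: conj_orbit_def)
  qed
  obtain h where h: "h \<in> N" "y = h \<otimes> x \<otimes> inv h" using y by (auto simp: conj_orbit_def)
  have hG: "h \<in> carrier G" using h subgroup.subset[OF N] by blast
  have "inv h \<otimes> y \<otimes> inv (inv h) = x"
    using hG x by (simp add: h m_assoc)
  then show ?thesis
    using sub[OF h(1) x] sub[OF subgroup.m_inv_closed[OF N h(1)], of y] h hG x by auto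
qed

lemma conj_orbit_disjoint:
  assumes "subgroup N G" "x \<in> carrier G" "y \<in> carrier G"
    "conj_orbit G N x \<noteq> conj_orbit G N y"
  shows "conj_orbit G N x \<inter> conj_orbit G N y = {}"
proof (rule ccontr)
  assume "\<not> ?thesis"
  then obtain z where "z \<in> conj_orbit G N x" "z \<in> conj_orbit G N y" by auto
  then show False using conj_orbit_eq[OF assms(1)] assms by metis
qed

text \<open>Orbit-stabilizer theorem: the map \<open>g \<otimes> x \<otimes> inv g\<close> on
  \<open>N\<close> has the left cosets of the centralizer of \<open>x\<close> in \<open>N\<close> as
  its fibres.\<close>

lemma card_conj_orbit:
  assumes fin: "finite (carrier G)" and N: "subgroup N G" and x: "x \<in> carrier G"
  shows "card (conj_orbit G N x) * card {g \<in> N. g \<otimes> x = x \<otimes> g} = card N"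
proof -
  note NG = subgroup.subset[OF N]
  have finN: "finite N" using fin NG finite_subset by blast
  let ?f = "\<lambda>g. g \<otimes> x \<otimes> inv g"
  let ?C = "{g \<in> N. g \<otimes> x = x \<otimes> g}"
  have fibre: "card {g \<in> N. ?f g = y} = card ?C" if y: "y \<in> ?f ` N" for y
  proof -
    obtain h where h: "h \<in> N" "y = ?f h" using y by auto
    have hG: "h \<in> carrier G" using h NG by blast
    \<comment> \<open>The fibre over the conjugate of \<open>x\<close> by \<open>h\<close> is the
      coset of \<open>?C\<close> with representative \<open>h\<close>.\<close>
    have "(\<lambda>g. h \<otimes> g) ` ?C = {g \<in> N. ?f g = y}"
    proof (intro equalityI subsetI)
      fix z assume "z \<in> (\<lambda>g. h \<otimes> g) ` ?C"
      then obtain g where g: "g \<in> N" "g \<otimes> x = x \<otimes> g" "z = h \<otimes> g" by auto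
      have gG: "g \<in> carrier G" using g NG by blast
      have "?f g = x" using conj_eq_iff[of g x x] g gG x by simp
      then have "?f z = y" using conj_mult[OF hG gG x] g h by simp
      then show "z \<in> {g \<in> N. ?f g = y}" using g h subgroup.m_closed[OF N] by simp
    next
      fix z assume z: "z \<in> {g \<in> N. ?f g = y}"
      then have zG: "z \<in> carrier G" using NG by blast
      have "?f (inv h \<otimes> z) = inv h \<otimes> ?f z \<otimes> inv (inv h)"
        using conj_mult[of "inv h" z x] hG zG x by simp
      also have "\<dots> = x" using z h hG x by (simp add: m_assoc)
      finally have "(inv h \<otimes> z) \<otimes> x = x \<otimes> (inv h \<otimes> z)"
        using conj_eq_iff[of "inv h \<otimes> z" x x] hG zG x by simp
      moreover have "inv h \<otimes> z \<in> N"
        using z h subgroup.m_closed[OF N] subgroup.m_inv_closed[OF N] by auto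
      moreover have "z = h \<otimes> (inv h \<otimes> z)" using hG zG by simp
      ultimately show "z \<in> (\<lambda>g. h \<otimes> g) ` ?C" by blast
    qed
    moreover have "inj_on (\<lambda>g. h \<otimes> g) ?C"
    proof (rule inj_onI)
      fix u v assume uv: "u \<in> ?C" "v \<in> ?C" "h \<otimes> u = h \<otimes> v"
      then have "u \<in> carrier G" "v \<in> carrier G" using NG by auto
      then show "u = v" using uv(3) hG by simp
    qed
    ultimately show ?thesis using card_image by fastforce
  qed
  have "card N = (\<Sum>y\<in>?f ` N. card {g \<in> N. ?f g = y})"
    unfolding card_eq_sum by (rule sum.image_gen[OF finN])
  also have "\<dots> = card (?f ` N) * card ?C"
    using fibre by simp
  finally show ?thesis by (simp add: conj_orbit_def)
qed

text \<open>Burnside's count: centralizer orders are constant on an orbit, so by the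
  orbit-stabilizer theorem each orbit contributes exactly \<open>card N\<close> to the sum.\<close>

lemma num_orbits_mult_card:
  assumes fin: "finite (carrier G)" and N: "subgroup N G" and A: "A \<subseteq> carrier G"
    and inv: "\<And>x. x \<in> A \<Longrightarrow> conj_orbit G N x \<subseteq> A"
  shows "num_orbits G N A * card N = (\<Sum>x\<in>A. card {g \<in> N. g \<otimes> x = x \<otimes> g})"
proof -
  let ?c = "\<lambda>x. card {g \<in> N. g \<otimes> x = x \<otimes> g}"
  let ?O = "conj_orbit G N ` A"
  have finA: "finite A" using A fin finite_subset by blast
  have U: "\<Union> ?O = A"
  proof
    show "\<Union> ?O \<subseteq> A" using inv by auto
    show "A \<subseteq> \<Union> ?O"
    proof
      fix x assume "x \<in> A"
      then show "x \<in> \<Union> ?O" using A conj_orbit_self[OF N, of x] by (intro UnionI[of "conj_orbit G N x"]) auto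
    qed
  qed
  have "(\<Sum>x\<in>A. ?c x) = (\<Sum>x\<in>\<Union> ?O. ?c x)" by (simp add: U)
  also have "\<dots> = (\<Sum>w\<in>?O. \<Sum>x\<in>w. ?c x)"
  proof (subst sum.Union_disjoint)
    show "\<forall>w\<in>?O. finite w" using finA inv finite_subset by blast
    show "\<forall>v\<in>?O. \<forall>w\<in>?O. v \<noteq> w \<longrightarrow> v \<inter> w = {}"
    proof (intro ballI impI)
      fix v w assume "v \<in> ?O" "w \<in> ?O" "v \<noteq> w"
      then obtain x y where "x \<in> A" "y \<in> A" "v = conj_orbit G N x" "w = conj_orbit G N y"
        by auto
      then show "v \<inter> w = {}"
        using conj_orbit_disjoint[OF N, of x y] A \<open>v \<noteq> w\<close> by auto
    qed
  qed simp
  also have "\<dots> = (\<Sum>w\<in>?O. card N)"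
  proof (rule sum.cong[OF refl])
    fix w assume "w \<in> ?O"
    then obtain x where x: "x \<in> A" "w = conj_orbit G N x" by auto
    have xG: "x \<in> carrier G" using x A by blast
    have "finite w" using inv[OF x(1)] x finA finite_subset by blast
    then have "card w \<noteq> 0" using conj_orbit_self[OF N xG] x by auto
    moreover have "card w * ?c y = card w * ?c x" if "y \<in> w" for y
      using card_conj_orbit[OF fin N, of y] card_conj_orbit[OF fin N xG]
        conj_orbit_eq[OF N xG, of y] that x inv[OF x(1)] A by auto
    ultimately have "?c y = ?c x" if "y \<in> w" for y using that by simp
    then have "(\<Sum>y\<in>w. ?c y) = card w * ?c x" by simp
    then show "(\<Sum>y\<in>w. ?c y) = card N" using card_conj_orbit[OF fin N xG] x by simp
  qed
  finally show ?thesis by (simp add: num_orbits_def)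
qed

lemma num_orbits_mono:
  assumes N: "subgroup N G" and M: "subgroup M G" and "N \<subseteq> M"
    and A: "A \<subseteq> carrier G" "finite A"
  shows "num_orbits G M A \<le> num_orbits G N A"
proof -
  have "conj_orbit G M x = (\<Union>y\<in>conj_orbit G N x. conj_orbit G M y)" if "x \<in> A" for x
  proof -
    have "conj_orbit G N x \<subseteq> conj_orbit G M x" using \<open>N \<subseteq> M\<close> by (auto simp: conj_orbit_def)
    then have "conj_orbit G M y = conj_orbit G M x" if "y \<in> conj_orbit G N x" for y
      using conj_orbit_eq[OF M, of x y] that \<open>x \<in> A\<close> A by blast
    then show ?thesis using conj_orbit_self[OF N, of x] that A by blast
  qed
  \<comment> \<open>An \<open>M\<close>-orbit is a function of any \<open>N\<close>-orbit inside it,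
    so there cannot be more of the former.\<close>
  then have "conj_orbit G M ` A = (\<lambda>w. \<Union>y\<in>w. conj_orbit G M y) ` conj_orbit G N ` A"
    unfolding image_image by (rule image_cong[OF refl])
  then show ?thesis unfolding num_orbits_def using A by (metis card_image_le finite_imageI)
qed

end

section \<open>Orbits of \<open>p'\<close>-elements in a coset\<close>

text \<open>For \<open>x\<close> of order dividing \<open>m * q\<close>, the powers
  \<open>x [^] e\<close> and \<open>x [^] f\<close> are the parts of \<open>x\<close> of order
  dividing \<open>m\<close> and \<open>q\<close>; below, \<open>q\<close> is a power of
  \<open>p\<close> and \<open>m\<close> is coprime to \<open>p\<close>.\<close>

lemma coprime_split_exponents:
  fixes m q :: nat
  assumes "coprime m q"
  obtains e f where "q dvd e" "m dvd f" "[e = 1] (mod m)" "[f = 1] (mod q)"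
proof -
  obtain e where "[e = 1] (mod m)" "[e = 0] (mod q)"
    using binary_chinese_remainder_nat[OF assms] by blast
  moreover obtain f where "[f = 0] (mod m)" "[f = 1] (mod q)"
    using binary_chinese_remainder_nat[OF assms] by blast
  ultimately show thesis using that by (auto simp: cong_0_iff)
qed

section \<open>Powers, orders and \<open>p'\<close>-elements\<close>

context group
begin

lemma pow_eq_one_dvd:
  assumes "x \<in> carrier G" "x [^] (n::nat) = \<one>" "n dvd k"
  shows "x [^] k = \<one>"
  using assms pow_eq_id dvd_trans by blast

lemma pow_cong:
  fixes i j n :: nat
  assumes x: "x \<in> carrier G" and "x [^] n = \<one>" and "[i = j] (mod n)"
  shows "x [^] i = x [^] j"
proof -
  have aux: "x [^] i = x [^] j" if "i \<le> j" "[i = j] (mod n)" for i j :: nat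
  proof -
    have "n dvd j - i"
      using that mod_eq_dvd_iff_nat[of i j n] by (simp add: cong_def)
    then have "x [^] (j - i) = \<one>" using assms pow_eq_one_dvd by blast
    moreover have "x [^] j = x [^] i \<otimes> x [^] (j - i)"
      using x that by (simp add: nat_pow_mult)
    ultimately show ?thesis using x by simp
  qed
  show ?thesis using aux[of i j] aux[of j i] assms(3) by (metis cong_sym nle_le)
qed

lemma pow_coprime_eq_one:
  fixes m n :: nat
  assumes "x \<in> carrier G" "x [^] m = \<one>" "x [^] n = \<one>" "coprime m n"
  shows "x = \<one>"
proof -
  have "ord x dvd 1" using assms by (metis coprime_def nat_dvd_1_iff_1 pow_eq_id dvd_refl)
  then show ?thesis using assms(1) ord_eq_1 by auto
qed

lemma subgroup_nat_pow_closed: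
  assumes "subgroup N G" "x \<in> N"
  shows "x [^] (n::nat) \<in> N"
  using assms by (induction n) (auto simp: subgroup.one_closed subgroup.m_closed)

lemma subgroup_card_pos:
  assumes "finite (carrier G)" "subgroup N G"
  shows "card N > 0"
  using assms subgroup.one_closed subgroup.subset finite_subset card_gt_0_iff by (metis empty_iff)

lemma subgroup_pow_card_eq_one:
  assumes "finite (carrier G)" "subgroup N G" "x \<in> N"
  shows "x [^] card N = \<one>"
proof -
  interpret N: group "G\<lparr>carrier := N\<rparr>" using assms(2) by (rule subgroup_imp_group)
  show ?thesis
    using N.pow_order_eq_1[of x] assms(3) by (simp add: order_def nat_pow_consistent[symmetric])
qed

text \<open>An equation \<open>x [^] m = \<one>\<close> is easier to carry through powers and
  conjugation than a condition on the order.\<close>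

lemma p'_elements_iff:
  assumes fin: "finite (carrier G)" and p: "Factorial_Ring.prime p"
    and ord: "order G = p ^ a * m" and m: "coprime m p"
  shows "x \<in> p'_elements G p \<longleftrightarrow> x \<in> carrier G \<and> x [^] m = \<one>"
proof (cases "x \<in> carrier G")
  case True
  have "ord x dvd p ^ a * m" using ord_dvd_group_order[OF True] ord by simp
  moreover have "coprime (ord x) (p ^ a)" if "\<not> p dvd ord x"
    using that p by (metis coprime_commute coprime_power_right_iff prime_imp_coprime)
  ultimately have "\<not> p dvd ord x \<Longrightarrow> ord x dvd m" by (simp add: coprime_dvd_mult_right_iff)
  moreover have "ord x dvd m \<Longrightarrow> \<not> p dvd ord x"
    using m p by (meson coprime_common_divisor dvd_refl dvd_trans not_prime_unit)
  ultimately show ?thesis using True pow_eq_id[OF True, of m] by (auto simp: p'_elements_def)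
qed (auto simp: p'_elements_def)

end

lemma prime_decompose:
  fixes n p :: nat
  assumes "Factorial_Ring.prime p" "n > 0"
  obtains a m where "n = p ^ a * m" "coprime m p"
proof -
  obtain m where "n = p ^ multiplicity p n * m" "\<not> p dvd m"
    using assms multiplicity_decompose'[of n p] by (metis not_prime_unit neq0_conv mult.commute)
  then show thesis using that assms by (metis coprime_commute prime_imp_coprime)
qed

context group
begin

lemma conj_pow:
  assumes "g \<in> carrier G" "x \<in> carrier G"
  shows "(g \<otimes> x \<otimes> inv g) [^] (n::nat) = g \<otimes> x [^] n \<otimes> inv g"
  by (induction n) (use assms in \<open>simp_all add: m_assoc\<close>)

lemma p'_elements_conj_closed:
  assumes fin: "finite (carrier G)" and p: "Factorial_Ring.prime p"
    and x: "x \<in> p'_elements G p" and g: "g \<in> carrier G"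
  shows "g \<otimes> x \<otimes> inv g \<in> p'_elements G p"
proof -
  have "order G > 0" using fin order_gt_0_iff_finite by simp
  then obtain a m where am: "order G = p ^ a * m" "coprime m p"
    using prime_decompose[OF p] by blast
  have xG: "x \<in> carrier G" and "x [^] m = \<one>" using x p'_elements_iff[OF fin p am] by auto
  then show ?thesis using p'_elements_iff[OF fin p am] conj_pow[OF g xG] g by simp
qed

text \<open>The \<open>N\<close>-orbits of \<open>p'\<close>-elements in a coset are counted by commuting pairs \<open>(y, c)\<close> with
  \<open>y\<close> a \<open>p'\<close>-element of the coset and \<open>c\<close> in \<open>N\<close>. Writing \<open>c\<close> as the product of its \<open>p'\<close>-part
  \<open>c [^] e\<close> and its \<open>p\<close>-part \<open>c [^] f\<close> and moving the latter over to \<open>y\<close> gives a commuting pair of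
  a \<open>p'\<close>-element of \<open>N\<close> and an element of the coset, from which \<open>(y, c)\<close> can be recovered.\<close>
lemma num_orbits_rcoset_le:
  assumes fin: "finite (carrier G)" and p: "Factorial_Ring.prime p"
    and N: "N \<lhd> G" and C: "C \<in> rcosets N"
  shows "num_orbits G N (C \<inter> p'_elements G p) \<le> num_orbits G N (N \<inter> p'_elements G p)"
proof -
  interpret N: normal N G by fact
  note NG = N.subset
  have sub: "subgroup N G" by (rule N.subgroup_axioms)
  let ?P = "p'_elements G p"
  have CG: "C \<subseteq> carrier G" using C rcosets_part_G[OF sub] by blast
  have finN: "finite N" and finC: "finite C" using NG CG fin finite_subset by blast+
  have "order G > 0" using fin order_gt_0_iff_finite by simp
  then obtain a m where am: "order G = p ^ a * m" "coprime m p"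
    using prime_decompose[OF p] by blast
  have P: "x \<in> ?P \<longleftrightarrow> x \<in> carrier G \<and> x [^] m = \<one>" for x
    by (rule p'_elements_iff[OF fin p am])
  have cop: "coprime m (p ^ a)" using am by simp
  obtain e f where ef: "p ^ a dvd e" "m dvd f" "[e = 1] (mod m)" "[f = 1] (mod p ^ a)"
    using coprime_split_exponents[OF cop] .
  have ord1: "x [^] (p ^ a * m) = \<one>" if "x \<in> carrier G" for x
    using pow_order_eq_1[OF that] am by simp
  \<comment> \<open>The sum \<open>e + f\<close> is 1 modulo both \<open>m\<close> and
    \<open>p ^ a\<close>, hence modulo the group order.\<close>
  have split: "x [^] e \<otimes> x [^] f = x" if x: "x \<in> carrier G" for x
  proof -
    have "[e + f = 1 + 0] (mod m)" using ef by (intro cong_add) (auto simp: cong_0_iff)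
    moreover have "[e + f = 0 + 1] (mod p ^ a)" using ef by (intro cong_add) (auto simp: cong_0_iff)
    ultimately have "[e + f = 1] (mod p ^ a * m)"
      using cop by (simp add: coprime_commute coprime_cong_mult_nat)
    then show ?thesis
      using pow_cong[OF x ord1[OF x]] x by (metis nat_pow_eone nat_pow_mult)
  qed
  have fe: "x [^] (f * e) = \<one>" if "x \<in> carrier G" for x
    using pow_eq_one_dvd[OF that ord1[OF that]] ef by (metis mult.commute mult_dvd_mono)
  have Pe: "x [^] e = x" if "x \<in> ?P" for x
    using pow_cong[of x m e 1] that ef by (auto simp: P)
  have eP: "x [^] e \<in> ?P" if "x \<in> carrier G" for x
    using pow_eq_one_dvd[OF that ord1[OF that], of "e * m"] ef that by (auto simp: P nat_pow_pow)
  \<comment> \<open>Normality makes every coset of \<open>N\<close> stable under conjugation by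
    \<open>N\<close>, so Burnside's count applies to its \<open>p'\<close>-elements.\<close>
  have Nconj: "g \<otimes> x \<otimes> inv g \<in> D" if D: "D \<in> rcosets N" and g: "g \<in> N" and x: "x \<in> D" for D g x
  proof -
    obtain d where d: "d \<in> carrier G" "D = N #> d" using D by (auto simp: RCOSETS_def)
    then obtain n where n: "n \<in> N" "x = n \<otimes> d" using x by (auto simp: r_coset_def)
    have "g \<otimes> x \<otimes> inv g = (g \<otimes> n \<otimes> (d \<otimes> inv g \<otimes> inv d)) \<otimes> d"
      using d n g NG by (simp add: m_assoc subsetD[OF NG])
    moreover have "g \<otimes> n \<otimes> (d \<otimes> inv g \<otimes> inv d) \<in> N"
      using d n g by (simp add: N.inv_op_closed2)
    ultimately show ?thesis using d by (auto simp: r_coset_def)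
  qed
  have orb: "num_orbits G N (D \<inter> ?P) * card N = (\<Sum>x\<in>D \<inter> ?P. card {g \<in> N. g \<otimes> x = x \<otimes> g})"
    if D: "D \<in> rcosets N" for D
  proof (rule num_orbits_mult_card[OF fin sub])
    show "D \<inter> ?P \<subseteq> carrier G" by (auto simp: P)
    show "conj_orbit G N x \<subseteq> D \<inter> ?P" if "x \<in> D \<inter> ?P" for x
      using that Nconj[OF D] p'_elements_conj_closed[OF fin p] NG by (auto simp: conj_orbit_def)
  qed
  \<comment> \<open>\<open>?A\<close> holds the pairs of Burnside's count on \<open>C\<close>; in
    \<open>?B\<close> the \<open>p'\<close>-condition has moved to the component in
    \<open>N\<close>.\<close>
  let ?A = "SIGMA y:C \<inter> ?P. {c \<in> N. c \<otimes> y = y \<otimes> c}"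
  let ?B = "SIGMA s:N \<inter> ?P. {z \<in> C. z \<otimes> s = s \<otimes> z}"
  have finB: "finite ?B" using finN finC by (intro finite_SigmaI) auto
  let ?h = "\<lambda>(y, c). (c [^] e, y \<otimes> c [^] f)"
  have "card ?A \<le> card ?B"
  proof (rule card_inj_on_le[of ?h])
    show "inj_on ?h ?A"
    proof (rule inj_onI, clarify)
      fix y c y' c'
      assume y: "y \<in> C" "y \<in> ?P" and c: "c \<in> N" "c \<otimes> y = y \<otimes> c"
        and y': "y' \<in> C" "y' \<in> ?P" and c': "c' \<in> N" "c' \<otimes> y' = y' \<otimes> c'"
        and eq: "c [^] e = c' [^] e" "y \<otimes> c [^] f = y' \<otimes> c' [^] f"
      have G: "y \<in> carrier G" "c \<in> carrier G" "y' \<in> carrier G" "c' \<in> carrier G"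
        using y y' c c' CG NG by auto
      \<comment> \<open>The exponent \<open>e\<close> kills the \<open>p\<close>-part
        \<open>c [^] f\<close> and fixes the \<open>p'\<close>-element \<open>y\<close>, so
        \<open>y\<close> can be read off the product.\<close>
      have rec: "(y \<otimes> c [^] f) [^] e = y"
        if "y \<in> ?P" "c \<otimes> y = y \<otimes> c" "y \<in> carrier G" "c \<in> carrier G" for y c
      proof -
        have "c [^] f \<otimes> y = y \<otimes> c [^] f" using that by (simp add: group_commutes_pow)
        then have "(y \<otimes> c [^] f) [^] e = y [^] e \<otimes> (c [^] f) [^] e"
          using that by (intro pow_mult_distrib) auto
        then show ?thesis using that fe Pe by (simp add: nat_pow_pow)
      qed
      have yy: "y = y'" using rec[of y c] rec[of y' c'] y y' c c' G eq by simp
      then have "c [^] f = c' [^] f" using eq G by simp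
      then have "c [^] e \<otimes> c [^] f = c' [^] e \<otimes> c' [^] f" using eq(1) by simp
      then have "c = c'" unfolding split[OF G(2)] split[OF G(4)] .
      with yy show "y = y' \<and> c = c'" by simp
    qed
    show "?h ` ?A \<subseteq> ?B"
    proof (rule image_subsetI)
      fix w assume "w \<in> ?A"
      then obtain y c where w: "w = (y, c)" and y: "y \<in> C" "y \<in> ?P"
        and c: "c \<in> N" "c \<otimes> y = y \<otimes> c" by auto
      have G: "y \<in> carrier G" "c \<in> carrier G" using y c CG NG by auto
      have 1: "c [^] e \<in> N \<inter> ?P" using subgroup_nat_pow_closed[OF sub c(1)] eP G by simp
      obtain d where d: "d \<in> carrier G" "C = N #> d" using C by (auto simp: RCOSETS_def)
      have cf: "c [^] f \<in> N" by (rule subgroup_nat_pow_closed[OF sub c(1)])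
      have cfy: "c [^] f \<otimes> y = y \<otimes> c [^] f" using c G by (simp add: group_commutes_pow)
      obtain n where n: "n \<in> N" "y = n \<otimes> d" using y d by (auto simp: r_coset_def)
      have "y \<otimes> c [^] f = c [^] f \<otimes> (n \<otimes> d)" using cfy n by simp
      also have "\<dots> = (c [^] f \<otimes> n) \<otimes> d"
        using d G subsetD[OF NG n(1)] by (simp add: m_assoc)
      finally have "y \<otimes> c [^] f = (c [^] f \<otimes> n) \<otimes> d" .
      moreover have "c [^] f \<otimes> n \<in> N" using cf n by simp
      ultimately have 2: "y \<otimes> c [^] f \<in> C" using d by (auto simp: r_coset_def)
      have "y \<otimes> c [^] f \<otimes> c [^] e = (y \<otimes> c [^] e) \<otimes> c [^] f"
        using G by (simp add: m_assoc nat_pow_mult add.commute)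
      also have "y \<otimes> c [^] e = c [^] e \<otimes> y" using c G by (simp add: group_commutes_pow)
      also have "(c [^] e \<otimes> y) \<otimes> c [^] f = c [^] e \<otimes> (y \<otimes> c [^] f)"
        using G by (simp add: m_assoc)
      finally have "y \<otimes> c [^] f \<otimes> c [^] e = c [^] e \<otimes> (y \<otimes> c [^] f)" .
      with 1 2 show "?h w \<in> ?B" by (simp add: w)
    qed
  qed (rule finB)
  moreover have "card ?A = num_orbits G N (C \<inter> ?P) * card N"
    unfolding orb[OF C] using finC finN by (subst card_SigmaI) auto
  moreover have "card ?B = (\<Sum>s\<in>N \<inter> ?P. card {z \<in> C. z \<otimes> s = s \<otimes> z})"
    using finC finN by (subst card_SigmaI) auto
  \<comment> \<open>The elements of \<open>C\<close> commuting with \<open>s\<close> are either none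
    or, after right translation by the inverse of one of them, elements of \<open>N\<close>
    commuting with \<open>s\<close>.\<close>
  moreover have "\<dots> \<le> (\<Sum>s\<in>N \<inter> ?P. card {g \<in> N. g \<otimes> s = s \<otimes> g})"
  proof (rule sum_mono)
    fix s assume s: "s \<in> N \<inter> ?P"
    then have sG: "s \<in> carrier G" using NG by auto
    show "card {z \<in> C. z \<otimes> s = s \<otimes> z} \<le> card {g \<in> N. g \<otimes> s = s \<otimes> g}"
    proof (cases "{z \<in> C. z \<otimes> s = s \<otimes> z} = {}")
      case False
      then obtain w where w: "w \<in> C" "w \<otimes> s = s \<otimes> w" by auto
      have wG: "w \<in> carrier G" using w CG by auto
      have CN: "C = N #> w"
        using C w repr_independence[OF _ _ sub] by (auto simp: RCOSETS_def)
      have iw: "inv w \<otimes> s = s \<otimes> inv w"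
      proof -
        have "inv w \<otimes> (w \<otimes> s) \<otimes> inv w = inv w \<otimes> (s \<otimes> w) \<otimes> inv w" using w by simp
        then show ?thesis using wG sG by (simp add: m_assoc)
      qed
      show ?thesis
      proof (rule card_inj_on_le[of "\<lambda>z. z \<otimes> inv w"])
        show "inj_on (\<lambda>z. z \<otimes> inv w) {z \<in> C. z \<otimes> s = s \<otimes> z}"
        proof (rule inj_onI)
          fix u v assume uv: "u \<in> {z \<in> C. z \<otimes> s = s \<otimes> z}" "v \<in> {z \<in> C. z \<otimes> s = s \<otimes> z}"
            "u \<otimes> inv w = v \<otimes> inv w"
          then have "u \<in> carrier G" "v \<in> carrier G" using CG by auto
          then show "u = v" using uv(3) wG by simp
        qed
        show "(\<lambda>z. z \<otimes> inv w) ` {z \<in> C. z \<otimes> s = s \<otimes> z} \<subseteq> {g \<in> N. g \<otimes> s = s \<otimes> g}"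
        proof (rule image_subsetI)
          fix z assume z: "z \<in> {z \<in> C. z \<otimes> s = s \<otimes> z}"
          then have zG: "z \<in> carrier G" using CG by auto
          obtain n where n: "n \<in> N" "z = n \<otimes> w" using z CN by (auto simp: r_coset_def)
          have "z \<otimes> inv w = n" using n wG subsetD[OF NG n(1)] by (simp add: m_assoc)
          moreover have "z \<otimes> inv w \<otimes> s = s \<otimes> (z \<otimes> inv w)"
          proof -
            have "z \<otimes> inv w \<otimes> s = z \<otimes> (s \<otimes> inv w)" using zG sG wG by (simp add: m_assoc iw)
            also have "\<dots> = (z \<otimes> s) \<otimes> inv w" using zG sG wG by (simp add: m_assoc)
            also have "\<dots> = s \<otimes> (z \<otimes> inv w)" using z zG sG wG by (simp add: m_assoc)
            finally show ?thesis .
          qed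
          ultimately show "z \<otimes> inv w \<in> {g \<in> N. g \<otimes> s = s \<otimes> g}" using n by simp
        qed
      qed (use finN in auto)
    next
      case True
      then show ?thesis by (simp only: card.empty le0)
    qed
  qed
  moreover have "\<dots> = num_orbits G N (N \<inter> ?P) * card N"
    using orb[of N] subgroup.subgroup_in_rcosets[OF sub group_axioms] by simp
  ultimately have "num_orbits G N (C \<inter> ?P) * card N \<le> num_orbits G N (N \<inter> ?P) * card N"
    by linarith
  moreover have "card N > 0" by (rule subgroup_card_pos[OF fin sub])
  ultimately show ?thesis by simp
qed

end

section \<open>Coprime action of a \<open>p\<close>-group\<close>

context group
begin

text \<open>Conjugation by \<open>y = x [^] d\<close> sends \<open>k\<close> to
  \<open>k \<otimes> c\<close> and fixes \<open>c\<close>, so its \<open>n\<close>-th iterate sends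
  \<open>k\<close> to \<open>k \<otimes> c [^] n\<close>. As \<open>y [^] (p ^ a)\<close> is
  trivial, \<open>c\<close> has \<open>p\<close>-power order in a \<open>p'\<close>-group and is
  trivial. So \<open>y\<close> commutes with \<open>k\<close>, and \<open>x\<close> is a power of
  \<open>y\<close>.\<close>

lemma coprime_action_coset_fixed:
  assumes fin: "finite (carrier G)" and K: "subgroup K G" and cop: "coprime (card K) p"
    and x: "x \<in> carrier G" "x [^] (p ^ a) = \<one>" and d: "coprime d p"
    and k: "k \<in> carrier G" and c: "c \<in> K" "c \<otimes> x = x \<otimes> c"
    and eq: "x [^] d \<otimes> k = k \<otimes> c \<otimes> x [^] d"
  shows "x \<otimes> k = k \<otimes> x"
proof -
  define y where "y = x [^] d"
  have cG: "c \<in> carrier G" using c subgroup.subset[OF K] by blast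
  have yG: "y \<in> carrier G" using x by (simp add: y_def)
  have "y \<otimes> c = c \<otimes> y" unfolding y_def using group_commutes_pow[of x c d] c x cG by simp
  then have yc: "y \<otimes> c [^] n = c [^] n \<otimes> y" for n :: nat
    using group_commutes_pow[of c y n] cG yG by simp
  have iter: "y [^] n \<otimes> k = k \<otimes> c [^] n \<otimes> y [^] n" for n :: nat
  proof (induction n)
    case (Suc n)
    have "y [^] Suc n \<otimes> k = y \<otimes> (y [^] n \<otimes> k)"
      using yG k by (simp only: nat_pow_Suc2 m_assoc nat_pow_closed)
    also have "\<dots> = (y \<otimes> k) \<otimes> c [^] n \<otimes> y [^] n" using Suc yG k cG by (simp add: m_assoc)
    also have "\<dots> = k \<otimes> c \<otimes> (y \<otimes> c [^] n) \<otimes> y [^] n"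
      using eq yG k cG by (simp add: m_assoc y_def[symmetric])
    also have "\<dots> = k \<otimes> (c \<otimes> c [^] n) \<otimes> (y \<otimes> y [^] n)"
      using yG k cG by (simp add: yc m_assoc)
    also have "\<dots> = k \<otimes> c [^] Suc n \<otimes> y [^] Suc n"
      using yG cG by (simp only: nat_pow_Suc2)
    finally show ?case .
  qed (use k yG in simp)
  have "y [^] (p ^ a) = \<one>"
    using x by (simp add: y_def nat_pow_pow) (metis dvd_triv_right pow_eq_one_dvd)
  then have "k = k \<otimes> c [^] (p ^ a)" using iter[of "p ^ a"] k cG by simp
  then have "c [^] (p ^ a) = \<one>" using k cG by (metis l_cancel_one nat_pow_closed)
  moreover have "c [^] card K = \<one>" by (rule subgroup_pow_card_eq_one[OF fin K c(1)])
  ultimately have "c = \<one>" using pow_coprime_eq_one[OF cG, of "card K" "p ^ a"] cop by simp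
  then have yk: "y \<otimes> k = k \<otimes> y" using eq k yG by (simp add: y_def)
  \<comment> \<open>The inverse \<open>j\<close> of \<open>d\<close> modulo \<open>p ^ a\<close>
    expresses \<open>x\<close> as \<open>y [^] j\<close>.\<close>
  obtain j where j: "[d * j = 1] (mod p ^ a)"
    using cong_solve_coprime_nat[of d "p ^ a"] d by auto
  have "x = x [^] (d * j)" using pow_cong[OF x(1) x(2) j] x by simp
  also have "\<dots> = y [^] j" using x by (simp add: y_def nat_pow_pow)
  finally show ?thesis using group_commutes_pow[OF yk yG k] by metis
qed

text \<open>If \<open>x\<close> moves \<open>k\<close>, then by coprimality the conjugates of \<open>k\<close> under \<open>x [^] i\<close> for \<open>i < p\<close> lie
  in \<open>p\<close> distinct cosets of \<open>C\<close> other than \<open>C\<close> itself, where \<open>C\<close> is the centralizer of \<open>x\<close> in \<open>K\<close>.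
  Hence \<open>C\<close> has index at least \<open>p + 1\<close>, and the orbits outside \<open>C\<close> have length at least \<open>p\<close>.\<close>
lemma num_orbits_coprime_action_le:
  assumes fin: "finite (carrier G)" and p: "Factorial_Ring.prime p"
    and K: "K \<lhd> G" and cop: "coprime (card K) p"
    and Y: "subgroup Y G" and x: "x \<in> Y" "x [^] (p ^ a) = \<one>"
    and k0: "k0 \<in> K" "x \<otimes> k0 \<noteq> k0 \<otimes> x"
  shows "(p + 1) * num_orbits G Y K \<le> 2 * card K"
proof -
  interpret K: normal K G by fact
  have subK: "subgroup K G" by (rule K.subgroup_axioms)
  note KG = subgroup.subset[OF subK]
  have finK: "finite K" using KG fin finite_subset by blast
  have xG: "x \<in> carrier G" using x subgroup.subset[OF Y] by blast
  define C where "C = {k \<in> K. x \<otimes> k = k \<otimes> x}"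
  have CK: "C \<subseteq> K" by (auto simp: C_def)
  have finC: "finite C" using CK finK finite_subset by blast
  have CG: "C \<subseteq> carrier G" using CK KG by blast
  have xC: "x [^] i \<otimes> c = c \<otimes> x [^] i" if "c \<in> C" for i :: nat and c
    using that xG CG by (intro group_commutes_pow) (auto simp: C_def)
  define cj where "cj i k = x [^] i \<otimes> k \<otimes> inv (x [^] i)" for i :: nat and k
  have cjG: "cj i k \<in> carrier G" if "k \<in> carrier G" for i k using that xG by (simp add: cj_def)
  have cjK: "cj i k \<in> K" if "k \<in> K" for i k using that xG by (simp add: cj_def K.inv_op_closed2)
  have cjC: "cj i k \<in> C \<longleftrightarrow> k \<in> C" if k: "k \<in> K" for i k
  proof
    have kG: "k \<in> carrier G" using k KG by blast
    assume "k \<in> C"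
    then have "cj i k = k" using xC[of k i] kG xG by (simp add: cj_def m_assoc)
    then show "cj i k \<in> C" using \<open>k \<in> C\<close> by simp
  next
    have kG: "k \<in> carrier G" using k KG by blast
    assume c: "cj i k \<in> C"
    have "cj i k \<otimes> x [^] i = x [^] i \<otimes> k" using kG xG by (simp add: cj_def m_assoc)
    then have "x [^] i \<otimes> cj i k = x [^] i \<otimes> k" using xC[OF c, of i] by simp
    then have "cj i k = k" using kG xG cjG by simp
    then show "k \<in> C" using c by simp
  qed
  \<comment> \<open>If the cosets of \<open>cj i k\<close> and \<open>cj j k\<close> met,
    conjugation by \<open>x [^] (j - i)\<close> would map \<open>k\<close> into its own coset of
    \<open>C\<close>. Since \<open>0 < j - i < p\<close>, the exponent is coprime to
    \<open>p\<close>, and \<open>coprime_action_coset_fixed\<close> would put \<open>k\<close> in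
    \<open>C\<close>.\<close>
  have distinct: False
    if ij: "i < j" "j < p" and k: "k \<in> K - C" and c: "c \<in> C" "c' \<in> C"
      and eq: "cj i k \<otimes> c = cj j k \<otimes> c'" for i j k c c'
  proof -
    have kG: "k \<in> carrier G" and cG: "c \<in> carrier G" "c' \<in> carrier G" using k c KG CG by auto
    define d where "d = j - i"
    have j: "x [^] j = x [^] i \<otimes> x [^] d" using ij xG by (simp add: d_def nat_pow_mult)
    have xi: "inv (x [^] i) \<otimes> c = c \<otimes> inv (x [^] i)" if "c \<in> C" for c and i :: nat
    proof -
      have G: "c \<in> carrier G" using that CG by blast
      have "inv (x [^] i) \<otimes> (x [^] i \<otimes> c) \<otimes> inv (x [^] i) = inv (x [^] i) \<otimes> (c \<otimes> x [^] i) \<otimes> inv (x [^] i)"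
        using xC[OF that] by simp
      then show ?thesis using G xG by (simp add: m_assoc)
    qed
    have "x [^] i \<otimes> (k \<otimes> c) \<otimes> inv (x [^] i) = cj i k \<otimes> c"
      using xi[OF c(1), of i] kG cG xG by (simp add: cj_def m_assoc)
    also have "\<dots> = cj j k \<otimes> c'" by (rule eq)
    also have "\<dots> = x [^] j \<otimes> k \<otimes> c' \<otimes> inv (x [^] j)"
      using xi[OF c(2), of j] kG cG xG by (simp add: cj_def m_assoc)
    also have "\<dots> = x [^] i \<otimes> (x [^] d \<otimes> k \<otimes> c' \<otimes> inv (x [^] d)) \<otimes> inv (x [^] i)"
      unfolding j using kG cG xG by (simp add: m_assoc inv_mult_group)
    finally have "k \<otimes> c = x [^] d \<otimes> k \<otimes> c' \<otimes> inv (x [^] d)"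
      using kG cG xG by simp
    then have "k \<otimes> c \<otimes> x [^] d = x [^] d \<otimes> k \<otimes> c'" using kG cG xG by (simp add: m_assoc)
    then have "k \<otimes> c \<otimes> x [^] d \<otimes> inv c' = x [^] d \<otimes> k" using kG cG xG by (simp add: m_assoc)
    moreover have "x [^] d \<otimes> inv c' = inv c' \<otimes> x [^] d"
    proof -
      have "inv c' \<otimes> (x [^] d \<otimes> c') \<otimes> inv c' = inv c' \<otimes> (c' \<otimes> x [^] d) \<otimes> inv c'"
        using xC[OF c(2)] by simp
      then show ?thesis using cG xG by (simp add: m_assoc)
    qed
    ultimately have e: "x [^] d \<otimes> k = k \<otimes> (c \<otimes> inv c') \<otimes> x [^] d"
      using kG cG xG by (metis inv_closed m_assoc m_closed nat_pow_closed)
    have "coprime d p"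
      using ij p unfolding d_def
      by (metis coprime_commute diff_is_0_eq less_imp_diff_less nat_dvd_not_less not_gr_zero not_le prime_imp_coprime)
    moreover have "c \<otimes> inv c' \<in> K" using c CK by auto
    moreover have "c \<otimes> inv c' \<otimes> x = x \<otimes> (c \<otimes> inv c')"
    proof -
      have x1: "x \<otimes> c = c \<otimes> x" "x \<otimes> c' = c' \<otimes> x" using c by (auto simp: C_def)
      have "inv c' \<otimes> (x \<otimes> c') \<otimes> inv c' = inv c' \<otimes> (c' \<otimes> x) \<otimes> inv c'" using x1 by simp
      then have "inv c' \<otimes> x = x \<otimes> inv c'" using cG xG by (simp add: m_assoc)
      then have "c \<otimes> inv c' \<otimes> x = c \<otimes> x \<otimes> inv c'" using cG xG by (simp add: m_assoc)
      then show ?thesis using x1 cG xG by (simp add: m_assoc[symmetric])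
    qed
    ultimately have "x \<otimes> k = k \<otimes> x"
      using coprime_action_coset_fixed[OF fin subK cop xG x(2) _ kG _ _ e] by simp
    then show False using k by (simp add: C_def)
  qed
  have inj: "i = j \<and> c = c'"
    if "i < p" "j < p" and k: "k \<in> K - C" and c: "c \<in> C" "c' \<in> C"
      and eq: "cj i k \<otimes> c = cj j k \<otimes> c'" for i j k c c'
  proof -
    have "i = j" using distinct[of i j k c c'] distinct[of j i k c' c] that by (metis nat_neq_iff)
    moreover have "cj i k \<in> carrier G" "c \<in> carrier G" "c' \<in> carrier G"
      using k c KG CG cjG by auto
    ultimately show ?thesis using eq by simp
  qed
  have oneC: "\<one> \<in> C" using K.one_closed xG by (simp add: C_def)
  have k0C: "k0 \<in> K - C" using k0 by (auto simp: C_def)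
  \<comment> \<open>The \<open>p\<close> cosets of the conjugates \<open>cj i k0\<close> are
    pairwise disjoint and avoid \<open>C\<close>, so together with \<open>C\<close> they make
    \<open>p + 1\<close> cosets in \<open>K\<close>.\<close>
  have index: "(p + 1) * card C \<le> card K"
  proof -
    let ?h = "\<lambda>(i, c). cj i k0 \<otimes> c"
    have "inj_on ?h ({..<p} \<times> C)" using inj[OF _ _ k0C] by (auto simp: inj_on_def)
    then have "card (?h ` ({..<p} \<times> C)) = p * card C"
      by (simp add: card_image card_cartesian_product)
    moreover have "?h ` ({..<p} \<times> C) \<subseteq> K - C"
    proof (rule image_subsetI)
      fix w assume "w \<in> {..<p} \<times> C"
      then obtain i c where w: "w = (i, c)" and c: "c \<in> C" by auto
      have G: "cj i k0 \<in> carrier G" "c \<in> carrier G" using k0 c KG CG cjG by auto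
      have "cj i k0 \<otimes> c \<notin> C"
      proof
        assume "cj i k0 \<otimes> c \<in> C"
        then have "x \<otimes> (cj i k0 \<otimes> c) = cj i k0 \<otimes> c \<otimes> x" by (simp add: C_def)
        also have "\<dots> = cj i k0 \<otimes> x \<otimes> c" using c G xG by (simp add: C_def m_assoc)
        finally have "x \<otimes> cj i k0 \<otimes> c = cj i k0 \<otimes> x \<otimes> c" using G xG by (simp add: m_assoc)
        then have "x \<otimes> cj i k0 = cj i k0 \<otimes> x" using G xG by simp
        then have "cj i k0 \<in> C" using cjK[OF k0(1)] by (simp add: C_def)
        then show False using cjC[OF k0(1)] k0C by simp
      qed
      then show "?h w \<in> K - C" using w cjK[OF k0(1)] c CK by auto
    qed
    ultimately have "p * card C \<le> card (K - C)" using card_mono finK by (metis finite_Diff)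
    then show ?thesis using card_Diff_subset[OF finC CK] card_mono[OF finK CK] by simp
  qed
  \<comment> \<open>\<open>?O1\<close> consists of the orbits meeting \<open>C\<close>, of which
    there are at most \<open>card C\<close>; the others lie in \<open>K - C\<close>.\<close>
  let ?O = "conj_orbit G Y ` K" and ?O1 = "conj_orbit G Y ` C"
  have O1: "card ?O1 \<le> card C" using finC by (rule card_image_le)
  have orbK: "conj_orbit G Y k \<subseteq> K" if "k \<in> K" for k
    using that subgroup.subset[OF Y] by (auto simp: conj_orbit_def K.inv_op_closed2)
  have O2: "w \<subseteq> K - C \<and> p \<le> card w" if w: "w \<in> ?O - ?O1" for w
  proof -
    obtain k where k: "k \<in> K" "w = conj_orbit G Y k" using w by auto
    have kG: "k \<in> carrier G" using k KG by blast
    have "w \<inter> C = {}"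
    proof (rule ccontr)
      assume "w \<inter> C \<noteq> {}"
      then obtain z where "z \<in> w" "z \<in> C" by auto
      then show False using w k conj_orbit_eq[OF Y kG, of z] by auto
    qed
    then have sub: "w \<subseteq> K - C" using orbK[OF k(1)] k by auto
    then have kC: "k \<in> K - C" using conj_orbit_self[OF Y kG] k by auto
    \<comment> \<open>Distinct cosets have distinct representatives: \<open>inj\<close> is used with
      both factors from \<open>C\<close> equal to \<open>\<one>\<close>.\<close>
    have "inj_on (\<lambda>i. cj i k) {..<p}"
      using inj[OF _ _ kC oneC oneC] cjG[OF kG] by (auto simp: inj_on_def)
    moreover have "(\<lambda>i. cj i k) ` {..<p} \<subseteq> w"
      using subgroup_nat_pow_closed[OF Y x(1)] by (auto simp: k conj_orbit_def cj_def)
    moreover have "finite w" using sub finK finite_subset by blast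
    ultimately have "card {..<p} \<le> card w" by (metis card_inj_on_le)
    then show ?thesis using sub by simp
  qed
  have "p * card (?O - ?O1) \<le> card (K - C)"
  proof -
    have "p * card (?O - ?O1) = (\<Sum>w\<in>?O - ?O1. p)" by simp
    also have "\<dots> \<le> (\<Sum>w\<in>?O - ?O1. card w)" using O2 by (intro sum_mono) auto
    also have "\<dots> = card (\<Union> (?O - ?O1))"
    proof (rule card_Union_disjoint[symmetric])
      show "pairwise disjnt (?O - ?O1)"
      proof (rule pairwiseI)
        fix v w assume "v \<in> ?O - ?O1" "w \<in> ?O - ?O1" "v \<noteq> w"
        then obtain y z where "y \<in> K" "z \<in> K" "v = conj_orbit G Y y" "w = conj_orbit G Y z"
          by auto
        then show "disjnt v w"
          using conj_orbit_disjoint[OF Y, of y z] KG \<open>v \<noteq> w\<close> by (auto simp: disjnt_def)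
      qed
      show "\<And>w. w \<in> ?O - ?O1 \<Longrightarrow> finite w" using O2 finK by (meson finite_Diff finite_subset)
    qed
    also have "\<dots> \<le> card (K - C)" using O2 finK by (intro card_mono) auto
    finally show ?thesis .
  qed
  moreover have "p * card ?O \<le> p * card C + p * card (?O - ?O1)"
  proof -
    have "?O = ?O1 \<union> (?O - ?O1)" using CK by auto
    then have "card ?O \<le> card ?O1 + card (?O - ?O1)" by (metis card_Un_le)
    then have "card ?O \<le> card C + card (?O - ?O1)" using O1 by linarith
    then show ?thesis by (metis distrib_left mult_le_mono2)
  qed
  moreover have "card (K - C) + card C = card K"
    using card_Diff_subset[OF finC CK] card_mono[OF finK CK] by simp
  ultimately have "p * card ?O + card C \<le> card K + p * card C"
    by linarith
  then have "p * num_orbits G Y K + card C \<le> card K + p * card C" by (simp add: num_orbits_def)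
  \<comment> \<open>With \<open>q = p - 1\<close>, multiplying the bound on the orbits by
    \<open>p + 1\<close> and using \<open>(p + 1) * card C \<le> card K\<close> gives
    \<open>(p + 1 + q) * card K = 2 * p * card K\<close>.\<close>
  moreover obtain q where q: "p = Suc q" using p prime_gt_0_nat gr0_conv_Suc by blast
  ultimately have 1: "p * num_orbits G Y K \<le> card K + q * card C" by simp
  have "p * ((p + 1) * num_orbits G Y K) = (p + 1) * (p * num_orbits G Y K)"
    by (simp add: distrib_left)
  also have "\<dots> \<le> (p + 1) * (card K + q * card C)" using 1 by (rule mult_le_mono2)
  also have "\<dots> = (p + 1) * card K + q * ((p + 1) * card C)" by (simp add: algebra_simps)
  also have "\<dots> \<le> (p + 1) * card K + q * card K" using index by simp
  also have "\<dots> = p * (2 * card K)" by (simp add: q)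
  finally show ?thesis using q by (metis mult_le_cancel1 zero_less_Suc)
qed

text \<open>Either a Sylow \<open>p\<close>-subgroup \<open>P\<close> of \<open>Y\<close> moves an
  element of \<open>K\<close>, and the orbit bound applies, or it centralizes \<open>K\<close>. Then
  \<open>Y\<close> is the direct product of \<open>P\<close> and \<open>K\<close>, and
  \<open>P\<close> is the set of all elements killed by \<open>p ^ a\<close>. This description of
  \<open>P\<close> makes its invariance under conjugation immediate later.\<close>

lemma num_orbits_le_or_p_elements_subgroup:
  assumes fin: "finite (carrier G)" and p: "Factorial_Ring.prime p"
    and K: "K \<lhd> G" and cop: "coprime (card K) p"
    and Y: "subgroup Y G" and KY: "K \<subseteq> Y" and card: "card Y = p ^ a * card K"
  shows "(p + 1) * num_orbits G Y K \<le> 2 * card K \<or>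
    (subgroup {y \<in> Y. y [^] (p ^ a) = \<one>} G \<and> card {y \<in> Y. y [^] (p ^ a) = \<one>} = p ^ a)"
proof -
  note YG = subgroup.subset[OF Y]
  have subK: "subgroup K G" by (rule normal_imp_subgroup[OF K])
  note KG = subgroup.subset[OF subK]
  have finY: "finite Y" using YG fin finite_subset by blast
  interpret Y: group "G\<lparr>carrier := Y\<rparr>" using Y by (rule subgroup_imp_group)
  obtain P where P': "subgroup P (G\<lparr>carrier := Y\<rparr>)" and cardP: "card P = p ^ a"
    using sylow_thm[OF p Y.group_axioms, of a "card K"] card finY by (auto simp: order_def)
  have P: "subgroup P G" using incl_subgroup[OF Y P'] .
  have PY: "P \<subseteq> Y" using subgroup.subset[OF P'] by simp
  have PG: "P \<subseteq> carrier G" using PY YG by blast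
  have Ppow: "u [^] (p ^ a) = \<one>" if "u \<in> P" for u
    using subgroup_pow_card_eq_one[OF fin P that] cardP by simp
  show ?thesis
  proof (cases "\<exists>x\<in>P. \<exists>k\<in>K. x \<otimes> k \<noteq> k \<otimes> x")
    case True
    then show ?thesis
      using num_orbits_coprime_action_le[OF fin p K cop Y] PY Ppow by blast
  next
    case False
    have trivial: "k = \<one>" if "k \<in> K" "k [^] (p ^ a) = \<one>" for k
      using pow_coprime_eq_one[of k "card K" "p ^ a"] that KG cop
        subgroup_pow_card_eq_one[OF fin subK] by auto
    let ?h = "\<lambda>(u, k). u \<otimes> k"
    \<comment> \<open>\<open>P\<close> and \<open>K\<close> meet trivially, so the products are
      distinct; comparing orders then shows that they fill \<open>Y\<close>.\<close>
    have inj: "inj_on ?h (P \<times> K)"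
    proof (rule inj_onI, clarify)
      fix u k u' k' assume uk: "u \<in> P" "k \<in> K" "u' \<in> P" "k' \<in> K" "u \<otimes> k = u' \<otimes> k'"
      then have G: "u \<in> carrier G" "k \<in> carrier G" "u' \<in> carrier G" "k' \<in> carrier G"
        using PG KG by auto
      have "inv u' \<otimes> (u \<otimes> k) \<otimes> inv k = inv u' \<otimes> (u' \<otimes> k') \<otimes> inv k" using uk by simp
      then have eq: "inv u' \<otimes> u = k' \<otimes> inv k" using G by (simp add: m_assoc)
      have "inv u' \<otimes> u \<in> P" using uk by (simp add: P subgroup.m_closed subgroup.m_inv_closed)
      moreover have "k' \<otimes> inv k \<in> K"
        using uk by (simp add: subK subgroup.m_closed subgroup.m_inv_closed)
      ultimately have "k' \<otimes> inv k = \<one>" using trivial Ppow eq by simp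
      then have kk: "k' = k" using G by (metis inv_equality inv_inv inv_closed)
      then show "u = u' \<and> k = k'" using uk(5) G by simp
    qed
    have "?h ` (P \<times> K) \<subseteq> Y" using PY KY subgroup.m_closed[OF Y] by auto
    moreover have "card (?h ` (P \<times> K)) = card Y"
      using card_image[OF inj] by (simp add: card cardP card_cartesian_product)
    ultimately have PK: "?h ` (P \<times> K) = Y" using finY by (simp add: card_subset_eq)
    have "{y \<in> Y. y [^] (p ^ a) = \<one>} = P"
    proof (intro equalityI subsetI)
      fix y assume y: "y \<in> {y \<in> Y. y [^] (p ^ a) = \<one>}"
      then obtain u k where uk: "u \<in> P" "k \<in> K" "y = u \<otimes> k" using PK by auto
      have G: "u \<in> carrier G" "k \<in> carrier G" using uk PG KG by auto
      \<comment> \<open>Because \<open>u\<close> and \<open>k\<close> commute, the power splits and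
        forces the component in \<open>K\<close> to be trivial.\<close>
      have "(u \<otimes> k) [^] (p ^ a) = u [^] (p ^ a) \<otimes> k [^] (p ^ a)"
        using False uk G by (intro pow_mult_distrib) auto
      then have "k [^] (p ^ a) = \<one>" using y uk Ppow[OF uk(1)] G by simp
      then have "k = \<one>" using trivial uk by blast
      then show "y \<in> P" using uk G by simp
    qed (use PY Ppow in auto)
    then show ?thesis using P cardP by simp
  qed
qed

end

section \<open>Class counts in extensions\<close>

context group
begin

text \<open>Every \<open>M\<close>-orbit of \<open>p'\<close>-elements meets a coset in
  \<open>T\<close>. Each such coset has at most as many \<open>N\<close>-orbits of
  \<open>p'\<close>-elements as \<open>N\<close> itself, and passing from \<open>N\<close> to
  \<open>M\<close> only merges orbits.\<close>

lemma num_orbits_cover_le: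
  assumes fin: "finite (carrier G)" and p: "Factorial_Ring.prime p"
    and N: "N \<lhd> G" and M: "subgroup M G" and NM: "N \<subseteq> M" and T: "T \<subseteq> rcosets N"
    and cover: "\<And>x. x \<in> M \<inter> p'_elements G p \<Longrightarrow> \<exists>g\<in>M. N #> (g \<otimes> x \<otimes> inv g) \<in> T"
  shows "num_orbits G M (M \<inter> p'_elements G p)
    \<le> card T * num_orbits G N (N \<inter> p'_elements G p)"
proof -
  let ?P = "p'_elements G p"
  have sub: "subgroup N G" using N by (rule normal_imp_subgroup)
  have PG: "?P \<subseteq> carrier G" by (auto simp: p'_elements_def)
  have finP: "finite ?P" using PG fin finite_subset by blast
  have finT: "finite T"
    using T fin rcosets_part_G[OF sub] by (metis finite_UnionD finite_subset)
  have "conj_orbit G M ` (M \<inter> ?P) \<subseteq> (\<Union>C\<in>T. conj_orbit G M ` (C \<inter> ?P))"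
  proof (rule image_subsetI)
    fix x assume x: "x \<in> M \<inter> ?P"
    then obtain g where g: "g \<in> M" "N #> (g \<otimes> x \<otimes> inv g) \<in> T" using cover by blast
    let ?y = "g \<otimes> x \<otimes> inv g"
    have xG: "x \<in> carrier G" and gG: "g \<in> carrier G" using x g subgroup.subset[OF M] by auto
    have "?y \<in> ?P" using p'_elements_conj_closed[OF fin p _ gG] x by blast
    moreover have "?y \<in> N #> ?y" using rcos_self[OF _ sub] xG gG by simp
    moreover have "conj_orbit G M x = conj_orbit G M ?y"
      using conj_orbit_eq[OF M xG, of ?y] g by (auto simp: conj_orbit_def)
    ultimately show "conj_orbit G M x \<in> (\<Union>C\<in>T. conj_orbit G M ` (C \<inter> ?P))" using g(2) by blast
  qed
  then have "num_orbits G M (M \<inter> ?P) \<le> card (\<Union>C\<in>T. conj_orbit G M ` (C \<inter> ?P))"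
    unfolding num_orbits_def using finT finP by (intro card_mono) auto
  also have "\<dots> \<le> (\<Sum>C\<in>T. num_orbits G M (C \<inter> ?P))"
    unfolding num_orbits_def by (rule card_UN_le[OF finT])
  also have "\<dots> \<le> (\<Sum>C\<in>T. num_orbits G N (N \<inter> ?P))"
  proof (rule sum_mono)
    fix C assume "C \<in> T"
    then have "C \<in> rcosets N" using T by blast
    moreover have "num_orbits G M (C \<inter> ?P) \<le> num_orbits G N (C \<inter> ?P)"
      using PG finP by (intro num_orbits_mono[OF sub M NM]) auto
    ultimately show "num_orbits G M (C \<inter> ?P) \<le> num_orbits G N (N \<inter> ?P)"
      using num_orbits_rcoset_le[OF fin p N] le_trans by blast
  qed
  finally show ?thesis by simp
qed

lemma rcosets_subgroup_eq: "rcosets\<^bsub>G\<lparr>carrier := M\<rparr>\<^esub> N = (\<lambda>x. N #> x) ` M"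
  by (auto simp: RCOSETS_def)

lemma card_rcosets_subgroup:
  assumes "finite (carrier G)" "N \<lhd> G" "subgroup M G" "N \<subseteq> M"
  shows "card ((\<lambda>x. N #> x) ` M) * card N = card M"
proof -
  interpret M: group "G\<lparr>carrier := M\<rparr>" using assms(3) by (rule subgroup_imp_group)
  have "subgroup N (G\<lparr>carrier := M\<rparr>)"
    using assms normal_imp_subgroup subgroup_incl by blast
  then show ?thesis
    using M.lagrange[of N] by (simp add: rcosets_subgroup_eq order_def)
qed

text \<open>In the quotient by \<open>N\<close>, the image of \<open>x\<close> has order dividing
  both a power of \<open>p\<close> and the order of \<open>x\<close>, so it is trivial.\<close>

lemma p'_elements_in_p_extension:
  assumes fin: "finite (carrier G)" and p: "Factorial_Ring.prime p"
    and N: "N \<lhd> G" and M: "subgroup M G" and NM: "N \<subseteq> M" and card: "card M = p ^ a * card N"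
  shows "M \<inter> p'_elements G p \<subseteq> N"
proof
  fix x assume x: "x \<in> M \<inter> p'_elements G p"
  have xG: "x \<in> carrier G" using x by (auto simp: p'_elements_def)
  interpret N: normal N G by fact
  have sub: "subgroup N G" by (rule N.subgroup_axioms)
  interpret Q: group "G Mod N" by (rule N.factorgroup_is_group)
  let ?Y = "(\<lambda>x. N #> x) ` M"
  have Y: "subgroup ?Y (G Mod N)"
    using normal_subgroup_factorize[OF N NM M] by (simp add: rcosets_subgroup_eq)
  have finQ: "finite (carrier (G Mod N))" using fin by (simp add: carrier_FactGroup)
  have "card N \<noteq> 0" using subgroup_card_pos[OF fin sub] by simp
  then have cY: "card ?Y = p ^ a" using card_rcosets_subgroup[OF fin N M NM] card by simp
  have "(N #> x) [^]\<^bsub>G Mod N\<^esub> card ?Y = \<one>\<^bsub>G Mod N\<^esub>"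
    by (rule Q.subgroup_pow_card_eq_one[OF finQ Y]) (use x in blast)
  moreover have "(N #> x) [^]\<^bsub>G Mod N\<^esub> ord x = \<one>\<^bsub>G Mod N\<^esub>"
    using N.FactGroup_pow[OF xG] N.subset xG by simp
  moreover have "coprime (card ?Y) (ord x)"
    using x p unfolding cY by (simp add: p'_elements_def prime_imp_coprime)
  moreover have "N #> x \<in> carrier (G Mod N)" using xG by (simp add: carrier_FactGroup)
  ultimately have "N #> x = N" using Q.pow_coprime_eq_one[of "N #> x" "card ?Y" "ord x"] by simp
  then show "x \<in> N" using rcos_self[OF xG sub] by simp
qed

text \<open>All \<open>p'\<close>-elements of \<open>M\<close> lie in \<open>N\<close>, so the
  single coset \<open>N\<close> serves as the cover.\<close>

lemma num_orbits_p_extension_le: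
  assumes fin: "finite (carrier G)" and p: "Factorial_Ring.prime p"
    and N: "N \<lhd> G" and M: "subgroup M G" and NM: "N \<subseteq> M" and card: "card M = p ^ a * card N"
  shows "num_orbits G M (M \<inter> p'_elements G p) \<le> num_orbits G N (N \<inter> p'_elements G p)"
proof -
  have sub: "subgroup N G" using N by (rule normal_imp_subgroup)
  have "\<exists>g\<in>M. N #> (g \<otimes> x \<otimes> inv g) \<in> {N}" if "x \<in> M \<inter> p'_elements G p" for x
  proof
    have "x \<in> N" using p'_elements_in_p_extension[OF assms] that by blast
    then show "N #> (\<one> \<otimes> x \<otimes> inv \<one>) \<in> {N}"
      using subgroup.mem_carrier[OF sub] coset_join2[OF _ sub] by simp
  qed (rule subgroup.one_closed[OF M])
  moreover have "{N} \<subseteq> rcosets N" using subgroup.subgroup_in_rcosets[OF sub group_axioms] by simp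
  ultimately show ?thesis using num_orbits_cover_le[OF fin p N M NM, of "{N}"] by simp
qed

text \<open>Here the cover consists of all \<open>c\<close> cosets of \<open>N\<close> in
  \<open>M\<close>.\<close>

lemma num_orbits_extension_le:
  assumes fin: "finite (carrier G)" and p: "Factorial_Ring.prime p"
    and N: "N \<lhd> G" and M: "subgroup M G" and NM: "N \<subseteq> M" and card: "card M = c * card N"
  shows "num_orbits G M (M \<inter> p'_elements G p) \<le> c * num_orbits G N (N \<inter> p'_elements G p)"
proof -
  have sub: "subgroup N G" using N by (rule normal_imp_subgroup)
  let ?T = "(\<lambda>x. N #> x) ` M"
  have "card N \<noteq> 0" using subgroup_card_pos[OF fin sub] by simp
  then have "card ?T = c" using card_rcosets_subgroup[OF fin N M NM] card by simp
  moreover have "?T \<subseteq> rcosets N" using subgroup.subset[OF M] by (auto simp: RCOSETS_def)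
  moreover have "\<exists>g\<in>M. N #> (g \<otimes> x \<otimes> inv g) \<in> ?T" if "x \<in> M \<inter> p'_elements G p" for x
    using that subgroup.one_closed[OF M] subgroup.subset[OF M] by (intro bexI[of _ \<one>]) auto
  ultimately show ?thesis using num_orbits_cover_le[OF fin p N M NM, of ?T] by simp
qed

text \<open>The dichotomy above is applied in the quotient by \<open>L\<close>, to the image of
  \<open>M\<close> acting on that of \<open>N\<close>. Few orbits give a small cover of the
  \<open>p'\<close>-elements of \<open>M\<close>; otherwise the subgroup of
  \<open>p\<close>-elements is pulled back to \<open>S\<close>.\<close>

lemma num_orbits_p'_p_extension_le:
  assumes fin: "finite (carrier G)" and p: "Factorial_Ring.prime p"
    and L: "L \<lhd> G" and N: "N \<lhd> G" and M: "M \<lhd> G" and LN: "L \<subseteq> N" and NM: "N \<subseteq> M"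
    and cardN: "card N = c * card L" and cop: "coprime c p" and cardM: "card M = p ^ a * card N"
  shows "(p + 1) * num_orbits G M (M \<inter> p'_elements G p)
      \<le> 2 * c * num_orbits G L (L \<inter> p'_elements G p) \<or>
    (\<exists>S. S \<lhd> G \<and> L \<subseteq> S \<and> S \<subseteq> M \<and> card S = p ^ a * card L)"
proof -
  interpret L: normal L G by fact
  have subL: "subgroup L G" by (rule L.subgroup_axioms)
  have subN: "subgroup N G" and subM: "subgroup M G" using N M normal_imp_subgroup by auto
  note MG = subgroup.subset[OF subM]
  have LM: "L \<subseteq> M" using LN NM by blast
  interpret Q: group "G Mod L" by (rule L.factorgroup_is_group)
  let ?q = "\<lambda>x. L #> x"
  let ?K = "?q ` N" and ?Y = "?q ` M"
  have finQ: "finite (carrier (G Mod L))" using fin by (simp add: carrier_FactGroup)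
  have K: "?K \<lhd> G Mod L" and Y: "?Y \<lhd> G Mod L"
    using normality_factorization[OF L LN N] normality_factorization[OF L LM M]
    by (simp_all add: rcosets_subgroup_eq)
  have subY: "subgroup ?Y (G Mod L)" using Y by (rule normal_imp_subgroup)
  have KY: "?K \<subseteq> ?Y" using NM by blast
  have cL: "card L \<noteq> 0" using subgroup_card_pos[OF fin subL] by simp
  have cK: "card ?K = c" using card_rcosets_subgroup[OF fin L subN LN] cardN cL by simp
  have cY: "card ?Y = p ^ a * card ?K"
    using card_rcosets_subgroup[OF fin L subM LM] cardN cardM cK cL by simp
  let ?S = "{y \<in> ?Y. y [^]\<^bsub>G Mod L\<^esub> (p ^ a) = \<one>\<^bsub>G Mod L\<^esub>}"
  consider (few) "(p + 1) * num_orbits (G Mod L) ?Y ?K \<le> 2 * card ?K"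
    | (complement) "subgroup ?S (G Mod L)" "card ?S = p ^ a"
    using Q.num_orbits_le_or_p_elements_subgroup[OF finQ p K _ subY KY cY] cK cop by auto
  then show ?thesis
  proof cases
    case few
    let ?O = "conj_orbit (G Mod L) ?Y"
    \<comment> \<open>One coset is chosen from each orbit of \<open>?Y\<close> on \<open>?K\<close>,
      so \<open>?T\<close> has at most as many members as there are orbits.\<close>
    let ?T = "(\<lambda>w. SOME C. C \<in> w) ` (?O ` ?K)"
    have finO: "finite (?O ` ?K)" using K finQ
      by (meson finite_imageI finite_subset normal_imp_subgroup subgroup.subset)
    have KQ: "?K \<subseteq> carrier (G Mod L)" using K normal_imp_subgroup subgroup.subset by blast
    have someO: "(SOME C. C \<in> ?O k) \<in> ?O k" if "k \<in> ?K" for k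
      using Q.conj_orbit_self[OF subY] that KQ by (metis someI_ex subsetD)
    have "?T \<subseteq> carrier (G Mod L)"
    proof -
      have "?O k \<subseteq> carrier (G Mod L)" if "k \<in> ?K" for k
        using Q.conj_orbit_closed[OF subgroup.subset[OF subY]] that KQ by blast
      then show ?thesis using someO by blast
    qed
    then have T: "?T \<subseteq> rcosets L" by (simp add: FactGroup_def)
    have cover: "\<exists>g\<in>M. L #> (g \<otimes> x \<otimes> inv g) \<in> ?T" if x: "x \<in> M \<inter> p'_elements G p" for x
    proof -
      \<comment> \<open>Only cosets inside \<open>N\<close> need covering, since \<open>M\<close>
        has \<open>p\<close>-power index over \<open>N\<close>.\<close>
      have xN: "x \<in> N" using p'_elements_in_p_extension[OF fin p N subM NM cardM] x by blast
      then have xK: "L #> x \<in> ?K" by blast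
      have xG: "x \<in> carrier G" using x MG by blast
      obtain g where g: "g \<in> M" "(SOME C. C \<in> ?O (L #> x)) =
          (L #> g) \<otimes>\<^bsub>G Mod L\<^esub> (L #> x) \<otimes>\<^bsub>G Mod L\<^esub> inv\<^bsub>G Mod L\<^esub> (L #> g)"
        using someO[OF xK] by (auto simp: conj_orbit_def)
      have gG: "g \<in> carrier G" using g MG by blast
      have "inv\<^bsub>G Mod L\<^esub> (L #> g) = L #> inv g"
        using L.inv_FactGroup[of "L #> g"] gG L.rcos_inv[OF gG] by (simp add: carrier_FactGroup)
      \<comment> \<open>The conjugation in the quotient that leads to the chosen coset is lifted to
        conjugation by \<open>g\<close>.\<close>
      then have "(SOME C. C \<in> ?O (L #> x)) = L #> (g \<otimes> x \<otimes> inv g)"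
        using g gG xG by (simp add: L.rcos_sum)
      then have "L #> (g \<otimes> x \<otimes> inv g) \<in> ?T" using xK by (metis image_eqI)
      then show ?thesis using g by blast
    qed
    let ?k = "\<lambda>M. num_orbits G M (M \<inter> p'_elements G p)"
    have "?k M \<le> card ?T * ?k L"
      by (rule num_orbits_cover_le[OF fin p L subM LM T cover])
    also have "\<dots> \<le> num_orbits (G Mod L) ?Y ?K * ?k L"
      unfolding num_orbits_def[of "G Mod L"] using card_image_le[OF finO] by (rule mult_le_mono1)
    finally have "(p + 1) * ?k M \<le> (p + 1) * num_orbits (G Mod L) ?Y ?K * ?k L"
      using mult_le_mono2 by (metis mult.assoc)
    also have "\<dots> \<le> 2 * c * ?k L" using few cK by (intro mult_le_mono1) simp
    finally show ?thesis by blast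
  next
    case complement
    \<comment> \<open>Conjugation commutes with powers and preserves the normal subgroup
      \<open>?Y\<close>, hence preserves \<open>?S\<close>.\<close>
    have "?S \<lhd> G Mod L"
      unfolding Q.normal_inv_iff
    proof (intro conjI ballI)
      fix x y assume x: "x \<in> carrier (G Mod L)" and y: "y \<in> ?S"
      have yQ: "y \<in> carrier (G Mod L)" using y subgroup.subset[OF subY] by blast
      have "(x \<otimes>\<^bsub>G Mod L\<^esub> y \<otimes>\<^bsub>G Mod L\<^esub> inv\<^bsub>G Mod L\<^esub> x) [^]\<^bsub>G Mod L\<^esub> (p ^ a)
          = x \<otimes>\<^bsub>G Mod L\<^esub> y [^]\<^bsub>G Mod L\<^esub> (p ^ a) \<otimes>\<^bsub>G Mod L\<^esub> inv\<^bsub>G Mod L\<^esub> x"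
        by (rule Q.conj_pow[OF x yQ])
      also have "\<dots> = \<one>\<^bsub>G Mod L\<^esub>" using y x Q.r_inv[OF x] Q.r_one[OF x] by (simp del: one_FactGroup mult_FactGroup)
      finally show "x \<otimes>\<^bsub>G Mod L\<^esub> y \<otimes>\<^bsub>G Mod L\<^esub> inv\<^bsub>G Mod L\<^esub> x \<in> ?S"
        using y normal.inv_op_closed2[OF Y x, of y] by (simp del: one_FactGroup mult_FactGroup)
    qed (rule complement(1))
    \<comment> \<open>The union of the cosets in \<open>?S\<close> is the preimage of
      \<open>?S\<close> in \<open>G\<close>.\<close>
    then have S: "\<Union> ?S \<lhd> G" by (rule L.factgroup_subgroup_union_normal)
    have Sq: "?S = ?q ` (\<Union> ?S)"
      by (rule L.factgroup_subgroup_union_factor[OF complement(1), unfolded rcosets_subgroup_eq])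
    have "L \<in> ?S" using subgroup.one_closed[OF complement(1)] by (simp only: one_FactGroup)
    then have LS: "L \<subseteq> \<Union> ?S" by (rule Union_upper)
    have "\<Union> ?S \<subseteq> M"
    proof
      fix x assume "x \<in> \<Union> ?S"
      then obtain m where m: "m \<in> M" "x \<in> L #> m" by auto
      then obtain l where "l \<in> L" "x = l \<otimes> m" by (auto simp: r_coset_def)
      then show "x \<in> M" using m LM subgroup.m_closed[OF subM] by blast
    qed
    moreover have "card (\<Union> ?S) = p ^ a * card L"
      using card_rcosets_subgroup[OF fin L normal_imp_subgroup[OF S] LS]
      unfolding Sq[symmetric] complement(2) ..
    ultimately show ?thesis using S LS by blast
  qed
qed

end

section \<open>Shortest series of \<open>p\<close>- and \<open>p'\<close>-steps\<close>

text \<open>The formula of \<open>order_p'\<close>, as a function of a number, so that it applies to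
  the order of each member of a series.\<close>

definition p'_part :: "nat \<Rightarrow> nat \<Rightarrow> nat" where
  "p'_part p n = Max {d. d dvd n \<and> coprime d p}"

lemma p'_part_eq:
  assumes "coprime h p" "h > 0" "p > 0"
  shows "p'_part p (p ^ a * h) = h"
  unfolding p'_part_def
proof (rule Max_eqI)
  have "{d. d dvd p ^ a * h \<and> coprime d p} \<subseteq> {..p ^ a * h}"
    using assms by (auto intro: dvd_imp_le)
  then show "finite {d. d dvd p ^ a * h \<and> coprime d p}" using finite_subset by blast
  show "d \<le> h" if "d \<in> {d. d dvd p ^ a * h \<and> coprime d p}" for d
    using that assms by (auto simp: coprime_dvd_mult_right_iff intro: dvd_imp_le)
qed (use assms in simp)

lemma p'_part_power_mult:
  assumes "Factorial_Ring.prime p" "n > 0"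
  shows "p'_part p (p ^ a * n) = p'_part p n"
proof -
  obtain b h where h: "n = p ^ b * h" "coprime h p" using prime_decompose[OF assms] .
  have pos: "h > 0" "p > 0" using h assms by (auto intro: prime_gt_0_nat gr0I)
  show ?thesis
    using p'_part_eq[OF h(2) pos, of "a + b"] p'_part_eq[OF h(2) pos, of b] h(1)
    by (simp add: power_add mult.assoc)
qed

lemma p'_part_coprime_mult:
  assumes "Factorial_Ring.prime p" "n > 0" "coprime c p"
  shows "p'_part p (c * n) = c * p'_part p n"
proof -
  obtain b h where h: "n = p ^ b * h" "coprime h p" using prime_decompose[OF assms(1,2)] .
  have pos: "h > 0" "p > 0" using h assms by (auto intro: prime_gt_0_nat gr0I)
  have "c > 0" using assms(1,3) by (cases "c = 0") auto
  then show ?thesis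
    using p'_part_eq[of "c * h" p b] p'_part_eq[OF h(2) pos, of b] h assms pos
    by (simp add: mult.left_commute)
qed

definition p_step :: "('a, 'b) monoid_scheme \<Rightarrow> nat \<Rightarrow> 'a set \<Rightarrow> 'a set \<Rightarrow> bool" where
  "p_step G p N M \<longleftrightarrow> N \<lhd> G \<and> M \<lhd> G \<and> N \<subseteq> M \<and> (\<exists>a. card M = p ^ a * card N)"

definition p'_step :: "('a, 'b) monoid_scheme \<Rightarrow> nat \<Rightarrow> 'a set \<Rightarrow> 'a set \<Rightarrow> bool" where
  "p'_step G p N M \<longleftrightarrow> N \<lhd> G \<and> M \<lhd> G \<and> N \<subseteq> M \<and> (\<exists>c. coprime c p \<and> card M = c * card N)"

text \<open>Encodes a normal series up to \<open>M\<close> in which \<open>p'\<close>-steps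
  alternate with \<open>k\<close> \<open>p\<close>-steps. Steps may be trivial, so \<open>k\<close>
  bounds the number of nontrivial \<open>p\<close>-factors from above.\<close>

primrec p_reach :: "('a, 'b) monoid_scheme \<Rightarrow> nat \<Rightarrow> nat \<Rightarrow> 'a set \<Rightarrow> bool" where
  "p_reach G p 0 M = p'_step G p {\<one>\<^bsub>G\<^esub>} M"
| "p_reach G p (Suc k) M = (\<exists>N N'. p_reach G p k N \<and> p_step G p N N' \<and> p'_step G p N' M)"

lemma p'_step_refl: "N \<lhd> G \<Longrightarrow> p'_step G p N N"
  unfolding p'_step_def by (auto intro: exI[of _ 1])

text \<open>Adjacent \<open>p\<close>-steps count as one; this merging is what contradicts
  minimality in \<open>k_sub_le\<close>.\<close>

lemma p_step_trans: "p_step G p L N \<Longrightarrow> p_step G p N M \<Longrightarrow> p_step G p L M"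
  unfolding p_step_def by (auto simp: mult.assoc[symmetric] power_add[symmetric])

lemma p'_step_trans:
  assumes "p'_step G p L N" "p'_step G p N M"
  shows "p'_step G p L M"
proof -
  obtain c d where "coprime c p" "card N = c * card L" "coprime d p" "card M = d * card N"
    using assms unfolding p'_step_def by blast
  then have "coprime (d * c) p" "card M = (d * c) * card L" by simp_all
  then show ?thesis using assms unfolding p'_step_def by blast
qed

lemma p_reach_p'_step: "p_reach G p k N \<Longrightarrow> p'_step G p N M \<Longrightarrow> p_reach G p k M"
  by (cases k) (auto intro: p'_step_trans)

lemma p_reach_p_step: "p_reach G p k N \<Longrightarrow> p_step G p N M \<Longrightarrow> p_reach G p (Suc k) M"
  by (auto simp: p_step_def intro: p'_step_refl)

lemma Collect_less_Suc:
  "{j. j < Suc i \<and> P j} = (if P i then insert i {j. j < i \<and> P j} else {j. j < i \<and> P j})"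
  by (auto simp: less_Suc_eq)

section \<open>Passage between normal series and \<open>p_reach\<close>\<close>

context group
begin

lemma p_series_imp_p_reach:
  assumes fin: "finite (carrier G)" and p: "Factorial_Ring.prime p" and ser: "p_series G p n H"
  shows "i \<le> n \<Longrightarrow> p_reach G p (card {j. j < i \<and> (\<exists>m>0. factor_order H j = p ^ m)}) (H i)"
proof (induction i)
  case 0
  then show ?case
    using ser one_is_normal by (auto simp: p_series_def intro: p'_step_refl)
next
  case (Suc i)
  let ?A = "\<lambda>i. {j. j < i \<and> (\<exists>m>0. factor_order H j = p ^ m)}"
  have IH: "p_reach G p (card (?A i)) (H i)" using Suc by simp
  have nor: "H i \<lhd> G" "H (Suc i) \<lhd> G" and sub: "H i \<subseteq> H (Suc i)"
    and fac: "(\<exists>m. factor_order H i = p ^ m) \<or> coprime (factor_order H i) p"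
    using ser Suc.prems by (auto simp: p_series_def)
  have "card (H i) dvd card (H (Suc i))"
    using card_rcosets_subgroup[OF fin nor(1) normal_imp_subgroup[OF nor(2)] sub]
    by (metis dvd_triv_right)
  then have card: "card (H (Suc i)) = factor_order H i * card (H i)"
    by (simp add: factor_order_def)
  show ?case
  proof (cases "\<exists>m>0. factor_order H i = p ^ m")
    case True
    then have "?A (Suc i) = insert i (?A i)" by (simp only: Collect_less_Suc if_True)
    then have "card (?A (Suc i)) = Suc (card (?A i))" by simp
    moreover have "p_step G p (H i) (H (Suc i))"
      using True nor sub card by (auto simp: p_step_def)
    ultimately show ?thesis using p_reach_p_step[OF IH] by simp
  next
    case False
    then have "?A (Suc i) = ?A i" by (simp only: Collect_less_Suc if_False)
    \<comment> \<open>A factor of order \<open>p ^ 0 = 1\<close> is not counted as a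
      \<open>p\<close>-factor and is absorbed as a \<open>p'\<close>-step.\<close>
    moreover have "coprime (factor_order H i) p"
      using fac False by (metis coprime_1_left gr0I power_0)
    then have "p'_step G p (H i) (H (Suc i))"
      using nor sub card by (auto simp: p'_step_def)
    ultimately show ?thesis using p_reach_p'_step[OF IH] by simp
  qed
qed

text \<open>A \<open>p_series\<close> ending at \<open>M\<close> instead of the whole group, with
  all members still normal in \<open>G\<close>, so that series can be built by induction.\<close>

definition p_chain :: "nat \<Rightarrow> nat \<Rightarrow> (nat \<Rightarrow> 'a set) \<Rightarrow> 'a set \<Rightarrow> bool" where
  "p_chain p n H M \<longleftrightarrow> H 0 = {\<one>} \<and> H n = M \<and>
     (\<forall>i\<le>n. H i \<lhd> G) \<and> (\<forall>i<n. H i \<subseteq> H (Suc i)) \<and>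
     (\<forall>i<n. (\<exists>m. factor_order H i = p ^ m) \<or> coprime (factor_order H i) p)"

lemma p_chain_extend:
  assumes chain: "p_chain p n H N" and M: "M \<lhd> G" "N \<subseteq> M"
    and c: "card M div card N = c" "(\<exists>m. c = p ^ m) \<or> coprime c p"
  shows "p_chain p (Suc n) (H(Suc n := M)) M"
    and "num_p_factors p (Suc n) (H(Suc n := M))
      = num_p_factors p n H + (if \<exists>m>0. c = p ^ m then 1 else 0)"
proof -
  let ?H = "H(Suc n := M)"
  have f: "factor_order ?H i = factor_order H i" if "i < n" for i
    using that by (auto simp: factor_order_def)
  have fn: "factor_order ?H n = c"
    using chain c(1) by (simp add: factor_order_def p_chain_def)
  show "p_chain p (Suc n) ?H M"
    using chain M c(2) f fn unfolding p_chain_def by (auto simp: less_Suc_eq le_Suc_eq)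
  let ?A = "{i. i < n \<and> (\<exists>m>0. factor_order H i = p ^ m)}"
  have A: "{i. i < n \<and> (\<exists>m>0. factor_order ?H i = p ^ m)} = ?A"
    using f by (simp cong: conj_cong)
  have "{i. i < Suc n \<and> (\<exists>m>0. factor_order ?H i = p ^ m)}
      = (if \<exists>m>0. c = p ^ m then insert n ?A else ?A)"
    by (simp only: Collect_less_Suc fn A)
  then show "num_p_factors p (Suc n) ?H
      = num_p_factors p n H + (if \<exists>m>0. c = p ^ m then 1 else 0)"
    by (simp add: num_p_factors_def)
qed

text \<open>The count is only bounded, since a step of exponent 0 adds no
  \<open>p\<close>-factor.\<close>

lemma p_chain_p_step:
  assumes fin: "finite (carrier G)" and chain: "p_chain p n H N" and step: "p_step G p N M"
  shows "\<exists>n' H'. p_chain p n' H' M \<and> num_p_factors p n' H' \<le> Suc (num_p_factors p n H)"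
proof -
  obtain a where a: "card M = p ^ a * card N" using step by (auto simp: p_step_def)
  have NM: "N \<lhd> G" "M \<lhd> G" "N \<subseteq> M" using step by (auto simp: p_step_def)
  have "card N > 0" using subgroup_card_pos[OF fin normal_imp_subgroup[OF NM(1)]] .
  then have "card M div card N = p ^ a" using a by simp
  then show ?thesis using p_chain_extend[OF chain NM(2,3), of "p ^ a"] by force
qed

lemma p_chain_p'_step:
  assumes fin: "finite (carrier G)" and p: "Factorial_Ring.prime p"
    and chain: "p_chain p n H N" and step: "p'_step G p N M"
  shows "\<exists>n' H'. p_chain p n' H' M \<and> num_p_factors p n' H' = num_p_factors p n H"
proof -
  obtain c where c: "card M = c * card N" "coprime c p" using step by (auto simp: p'_step_def)
  have NM: "N \<lhd> G" "M \<lhd> G" "N \<subseteq> M" using step by (auto simp: p'_step_def)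
  have "card N > 0" using subgroup_card_pos[OF fin normal_imp_subgroup[OF NM(1)]] .
  then have div: "card M div card N = c" using c by simp
  have none: "\<not> (\<exists>m>0. c = p ^ m)"
    using c(2) p by (metis coprime_power_left_iff coprime_self not_prime_unit neq0_conv)
  show ?thesis
    using p_chain_extend[OF chain NM(2,3) div disjI2[OF c(2)]] unfolding if_not_P[OF none] by auto
qed

lemma p_reach_imp_p_chain:
  assumes fin: "finite (carrier G)" and p: "Factorial_Ring.prime p"
  shows "p_reach G p k M \<Longrightarrow> \<exists>n H. p_chain p n H M \<and> num_p_factors p n H \<le> k"
proof (induction k arbitrary: M)
  case 0
  have "p_chain p 0 (\<lambda>_. {\<one>}) {\<one>}" using one_is_normal by (simp add: p_chain_def)
  then show ?case
    using p_chain_p'_step[OF fin p, of 0 "\<lambda>_. {\<one>}" "{\<one>}" M] 0 by (auto simp: num_p_factors_def)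
next
  case (Suc k)
  then obtain N N' where N: "p_reach G p k N" "p_step G p N N'" "p'_step G p N' M" by auto
  obtain n H where 1: "p_chain p n H N" "num_p_factors p n H \<le> k" using Suc.IH[OF N(1)] by blast
  obtain n' H' where 2: "p_chain p n' H' N'" "num_p_factors p n' H' \<le> Suc (num_p_factors p n H)"
    using p_chain_p_step[OF fin 1(1) N(2)] by blast
  obtain n'' H'' where "p_chain p n'' H'' M" "num_p_factors p n'' H'' = num_p_factors p n' H'"
    using p_chain_p'_step[OF fin p 2(1) N(3)] by blast
  then show ?case using 1(2) 2(2) by (intro exI[of _ n''] exI[of _ H'']) simp
qed

text \<open>Used in contrapositive form: fewer \<open>p\<close>-steps than the
  \<open>p\<close>-length cannot reach the whole group.\<close>

lemma p_reach_carrier_imp_p_length_le: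
  assumes "finite (carrier G)" "Factorial_Ring.prime p" "p_reach G p k (carrier G)"
  shows "p_length G p \<le> k"
proof -
  obtain n H where nH: "p_chain p n H (carrier G)" "num_p_factors p n H \<le> k"
    using p_reach_imp_p_chain[OF assms] by blast
  then have "p_series G p n H" by (simp add: p_chain_def p_series_def)
  then have "p_length G p \<le> num_p_factors p n H"
    unfolding p_length_def by (intro Least_le) blast
  then show ?thesis using nH by simp
qed

lemma p_reach_p_length:
  assumes "finite (carrier G)" "Factorial_Ring.prime p" "p_solvable G p"
  shows "p_reach G p (p_length G p) (carrier G)"
proof -
  have "\<exists>k n H. p_series G p n H \<and> num_p_factors p n H = k"
    using assms(3) by (auto simp: p_solvable_def)
  then have "\<exists>n H. p_series G p n H \<and> num_p_factors p n H = p_length G p"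
    unfolding p_length_def by (rule LeastI_ex)
  then obtain n H where nH: "p_series G p n H" "num_p_factors p n H = p_length G p" by blast
  then show ?thesis
    using p_series_imp_p_reach[OF assms(1,2) nH(1), of n]
    by (simp add: num_p_factors_def p_series_def)
qed

text \<open>For a subgroup \<open>M\<close> this is \<open>k_p'\<close> of \<open>M\<close> as a
  group, because orders of elements are the same in \<open>M\<close> and in
  \<open>G\<close>.\<close>

abbreviation k_sub :: "nat \<Rightarrow> 'a set \<Rightarrow> nat" where
  "k_sub p M \<equiv> num_orbits G M (M \<inter> p'_elements G p)"

section \<open>Class counts along a shortest series\<close>

lemma k_sub_p_step:
  assumes fin: "finite (carrier G)" and p: "Factorial_Ring.prime p" and step: "p_step G p N M"
  shows "k_sub p M \<le> k_sub p N" and "p'_part p (card M) = p'_part p (card N)"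
proof -
  obtain a where a: "card M = p ^ a * card N" and NM: "N \<lhd> G" "M \<lhd> G" "N \<subseteq> M"
    using step by (auto simp: p_step_def)
  show "k_sub p M \<le> k_sub p N"
    by (rule num_orbits_p_extension_le[OF fin p NM(1) normal_imp_subgroup[OF NM(2)] NM(3) a])
  show "p'_part p (card M) = p'_part p (card N)"
    using p'_part_power_mult[OF p subgroup_card_pos[OF fin normal_imp_subgroup[OF NM(1)]]] a by simp
qed

text \<open>The step multiplies the \<open>p'\<close>-part of the order by \<open>c\<close> and the
  class count by at most \<open>c\<close>, so a bound \<open>r\<close> on their ratio
  survives.\<close>

lemma k_sub_p'_step:
  assumes fin: "finite (carrier G)" and p: "Factorial_Ring.prime p" and step: "p'_step G p N M"
    and le: "real (k_sub p N) \<le> r * real (p'_part p (card N))"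
  shows "real (k_sub p M) \<le> r * real (p'_part p (card M))"
proof -
  obtain c where c: "card M = c * card N" "coprime c p" and NM: "N \<lhd> G" "M \<lhd> G" "N \<subseteq> M"
    using step by (auto simp: p'_step_def)
  have "k_sub p M \<le> c * k_sub p N"
    by (rule num_orbits_extension_le[OF fin p NM(1) normal_imp_subgroup[OF NM(2)] NM(3) c(1)])
  then have "real (k_sub p M) \<le> real c * real (k_sub p N)"
    by (metis of_nat_le_iff of_nat_mult)
  also have "\<dots> \<le> real c * (r * real (p'_part p (card N)))"
    using le by (intro mult_left_mono) auto
  also have "\<dots> = r * real (p'_part p (card M))"
    using p'_part_coprime_mult[OF p subgroup_card_pos[OF fin normal_imp_subgroup[OF NM(1)]] c(2)]
      c(1) by simp
  finally show ?thesis .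
qed

text \<open>The ratio is at most 1 for the trivial subgroup, and neither kind of step pushes it
  above 1.\<close>

lemma k_sub_le_p'_part:
  assumes fin: "finite (carrier G)" and p: "Factorial_Ring.prime p"
  shows "p_reach G p k M \<Longrightarrow> real (k_sub p M) \<le> real (p'_part p (card M))"
proof (induction k arbitrary: M)
  case 0
  have "k_sub p {\<one>} \<le> card ({\<one>} \<inter> p'_elements G p)"
    unfolding num_orbits_def by (intro card_image_le) simp
  also have "\<dots> \<le> 1" by (metis card_mono finite.emptyI finite_insert inf_le1 is_singletonI is_singleton_altdef)
  finally have "real (k_sub p {\<one>}) \<le> 1 * real (p'_part p (card {\<one>}))"
    using p'_part_eq[of 1 p 0] p prime_gt_0_nat[of p] by simp
  then show ?case using k_sub_p'_step[OF fin p, of "{\<one>}" M 1] 0 by simp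
next
  case (Suc k)
  then obtain N N' where N: "p_reach G p k N" "p_step G p N N'" "p'_step G p N' M" by auto
  have "real (k_sub p N') \<le> 1 * real (p'_part p (card N'))"
    using Suc.IH[OF N(1)] k_sub_p_step[OF fin p N(2)] by simp
  then show ?case using k_sub_p'_step[OF fin p N(3)] by fastforce
qed

text \<open>In a shortest series, the second of two successive \<open>p\<close>-factors cannot be moved below the
  \<open>p'\<close>-factor between them, for it would merge with the first. So it acts nontrivially on that
  \<open>p'\<close>-factor, which yields one factor \<open>2 / (p + 1)\<close>.\<close>
lemma k_sub_le:
  assumes fin: "finite (carrier G)" and p: "Factorial_Ring.prime p"
  shows "\<lbrakk>p_reach G p (Suc k) M; \<not> p_reach G p k M\<rbrakk>
    \<Longrightarrow> real (k_sub p M) \<le> (2 / (real p + 1)) ^ k * real (p'_part p (card M))"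
proof (induction k arbitrary: M)
  case 0
  then show ?case using k_sub_le_p'_part[OF fin p, of 1 M] by simp
next
  case (Suc k)
  let ?r = "2 / (real p + 1)"
  obtain N N' where N: "p_reach G p (Suc k) N" "p_step G p N N'" "p'_step G p N' M"
    using Suc.prems(1) by (subst (asm) p_reach.simps(2)) blast
  \<comment> \<open>The top of the series is
    \<open>L' \<subseteq> L \<subseteq> N \<subseteq> N' \<subseteq> M\<close>, with a
    \<open>p\<close>-, a \<open>p'\<close>-, a \<open>p\<close>- and a \<open>p'\<close>-step in
    this order.\<close>
  obtain L' L where L: "p_reach G p k L'" "p_step G p L' L" "p'_step G p L N"
    using N(1) by auto
  \<comment> \<open>Minimality descends from \<open>M\<close> to \<open>N'\<close>, then to
    \<open>N\<close> and \<open>L\<close> with one \<open>p\<close>-step less, so that the induction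
    hypothesis applies to \<open>L\<close>.\<close>
  have notN': "\<not> p_reach G p (Suc k) N'" using Suc.prems(2) N(3) p_reach_p'_step by blast
  then have "\<not> p_reach G p k N" using N(2) p_reach_p_step by blast
  then have "\<not> p_reach G p k L" using L(3) p_reach_p'_step by blast
  then have IH: "real (k_sub p L) \<le> ?r ^ k * real (p'_part p (card L))"
    using Suc.IH L(1,2) p_reach_p_step by blast
  obtain c where c: "coprime c p" "card N = c * card L" using L(3) by (auto simp: p'_step_def)
  obtain a where a: "card N' = p ^ a * card N" using N(2) by (auto simp: p_step_def)
  have nor: "L \<lhd> G" "N \<lhd> G" "N' \<lhd> G" and sub: "L \<subseteq> N" "N \<subseteq> N'"
    using L(3) N(2) by (auto simp: p'_step_def p_step_def)
  have "\<not> (\<exists>S. S \<lhd> G \<and> L \<subseteq> S \<and> S \<subseteq> N' \<and> card S = p ^ a * card L)"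
  proof
    assume "\<exists>S. S \<lhd> G \<and> L \<subseteq> S \<and> S \<subseteq> N' \<and> card S = p ^ a * card L"
    then obtain S where S: "S \<lhd> G" "L \<subseteq> S" "S \<subseteq> N'" "card S = p ^ a * card L" by blast
    then have "p_step G p L S" using nor by (auto simp: p_step_def)
    \<comment> \<open>The step from \<open>L\<close> to \<open>S\<close> merges with the one from
      \<open>L'\<close> to \<open>L\<close>, so \<open>S\<close> costs no further
      \<open>p\<close>-step; only a \<open>p'\<close>-step then remains up to
      \<open>N'\<close>.\<close>
    then have "p_reach G p (Suc k) S" using L(1,2) p_step_trans p_reach_p_step by blast
    moreover have "p'_step G p S N'"
    proof -
      have "card N' = c * card S" using a c(2) S(4) by simp
      then show ?thesis using S nor c(1) by (auto simp: p'_step_def)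
    qed
    ultimately show False using notN' p_reach_p'_step by blast
  qed
  then have "(p + 1) * k_sub p N' \<le> 2 * c * k_sub p L"
    using num_orbits_p'_p_extension_le[OF fin p nor sub c(2,1) a] by blast
  then have "real ((p + 1) * k_sub p N') \<le> real (2 * c * k_sub p L)" by (rule of_nat_mono)
  then have "real (k_sub p N') \<le> ?r * (real c * real (k_sub p L))"
    by (simp add: field_simps)
  also have "\<dots> \<le> ?r * (real c * (?r ^ k * real (p'_part p (card L))))"
    using IH by (intro mult_left_mono) auto
  also have "\<dots> = ?r ^ Suc k * real (p'_part p (card N))"
    using p'_part_coprime_mult[OF p subgroup_card_pos[OF fin normal_imp_subgroup[OF nor(1)]] c(1)]
      c(2) by simp
  also have "p'_part p (card N) = p'_part p (card N')" using k_sub_p_step(2)[OF fin p N(2)] by simp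
  finally show ?case using k_sub_p'_step[OF fin p N(3)] by blast
qed

lemma k_p'_eq_k_sub: "k_p' G p = k_sub p (carrier G)"
proof -
  have "carrier G \<inter> p'_elements G p = p'_elements G p" by (auto simp: p'_elements_def)
  moreover have "conj_class G = conj_orbit G (carrier G)"
    by (auto simp: conj_class_def conj_orbit_def fun_eq_iff)
  ultimately show ?thesis by (simp add: k_p'_def num_orbits_def)
qed

end

theorem theorem1p4:
  fixes G :: "('a, 'b) monoid_scheme" and p k :: nat
  assumes "group G" and "finite (carrier G)" and "Factorial_Ring.prime p"
    and "p_solvable G p" and "p_length G p = k"
  shows "d_p' G p \<le> (2 / (real p + 1)) powi (int k - 1)"
proof -
  interpret group G by fact
  note fin = assms(2) and p = assms(3)
  let ?n = "p'_part p (card (carrier G))"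
  have ord: "order_p' G p = ?n" by (simp add: order_p'_def p'_part_def order_def)
  have "card (carrier G) > 0" using subgroup_card_pos[OF fin subgroup_self] .
  then obtain a m where am: "card (carrier G) = p ^ a * m" "coprime m p"
    using prime_decompose[OF p] by blast
  then have "m > 0" using \<open>card (carrier G) > 0\<close> by (intro gr0I) simp
  then have pos: "?n > 0" using p'_part_eq[OF am(2)] am(1) prime_gt_0_nat[OF p] by simp
  have reach: "p_reach G p k (carrier G)" using p_reach_p_length[OF fin p assms(4)] assms(5) by simp
  show ?thesis
  proof (cases k)
    case 0
    \<comment> \<open>The exponent is -1 here, so the claimed bound is \<open>(p + 1) / 2\<close>,
      which is at least 1.\<close>
    have "d_p' G p \<le> 1"
      using k_sub_le_p'_part[OF fin p reach] pos by (simp add: d_p'_def ord k_p'_eq_k_sub)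
    also have "1 \<le> inverse (2 / (real p + 1))"
      using prime_gt_0_nat[OF p] by (simp add: field_simps)
    finally show ?thesis using 0 by (simp add: power_int_minus)
  next
    case (Suc j)
    \<comment> \<open>The \<open>p\<close>-length is \<open>Suc j\<close>, so \<open>j\<close>
      \<open>p\<close>-steps are too few; this supplies the minimality needed by
      \<open>k_sub_le\<close>.\<close>
    then have "\<not> p_reach G p j (carrier G)"
      using p_reach_carrier_imp_p_length_le[OF fin p, of j] assms(5) by auto
    then have "real (k_p' G p) \<le> (2 / (real p + 1)) ^ j * real ?n"
      using k_sub_le[OF fin p, of j "carrier G"] reach Suc by (simp add: k_p'_eq_k_sub)
    then have "d_p' G p \<le> (2 / (real p + 1)) ^ j"
      using pos by (simp add: d_p'_def ord divide_le_eq)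
    then show ?thesis using Suc by simp
  qed
qed

end
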